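(* Let $\Phi_1,\Phi_2$ be two stationary point processes on $\mathbb{R}^d$ with the same finite (positive) intensity, and let $K_1(r),K_2(r)$ denote their Ripley's $K$-functions. If $\Phi_1\le_{dcx}\Phi_2$, then $K_1(r)\le K_2(r)$ for all $r$.
   Context: A function $f:\mathbb{R}^n\to\mathbb{R}$ is directionally convex (dcx) if $f(x)+f(y)\le f(p)+f(q)$ whenever $p\le x,y\le q$ (componentwise) and $x+y=p+q$. For random vectors $X,Y$ of the same dimension, $X\le_{dcx}Y$ means $E f(X)\le E f(Y)$ for all dcx $f$ for which both expectations are finite. For point processes (random locally finite counting measures) on $\mathbb{R}^d$, $\Phi_1\le_{dcx}\Phi_2$ means $(\Phi_1(I_1),\dots,\Phi_1(I_n))\le_{dcx}(\Phi_2(I_1),\dots,\Phi_2(I_n))$ for all $n\ge1$ and all bounded Borel $I_1,\dots,I_n\subset\mathbb{R}^d$. For a stationary point process $\Phi$ on $\mathbb{R}^d$ with finite intensity $\lambda=E(\Phi(B))$ ($B$ any bounded Borel set of Lebesgue measure $1$), Ripley's $K$-function is $$K(r)=\frac1{\lambda|G|}E\Bigl(\sum_{X_i\in\Phi\cap G}\bigl(\Phi(B_{X_i}(r))-1\bigr)\Bigr),$$ where $B_x(r)$ is the ball of radius $r$ centered at $x$, $G$ is a bounded Borel set of positive Lebesgue measure $|G|$; by stationarity $K(r)$ does not depend on $G$. *)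

theory Defs
  imports "HOL-Probability.Probability"
begin

(* Vectors of R^n are the extensional functions on {..<n}, i.e. the points of
   the product space PiM {..<n} (\<lambda>_. borel). *)

definition dcx :: "nat \<Rightarrow> ((nat \<Rightarrow> real) \<Rightarrow> real) \<Rightarrow> bool" where
  "dcx n f \<longleftrightarrow>
     (\<forall>x \<in> {..<n} \<rightarrow>\<^sub>E UNIV. \<forall>y \<in> {..<n} \<rightarrow>\<^sub>E UNIV.
      \<forall>p \<in> {..<n} \<rightarrow>\<^sub>E UNIV. \<forall>q \<in> {..<n} \<rightarrow>\<^sub>E UNIV.
        (\<forall>i<n. p i \<le> x i \<and> x i \<le> q i \<and> p i \<le> y i \<and> y i \<le> q i \<and> x i + y i = p i + q i)
        \<longrightarrow> f x + f y \<le> f p + f q)"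

(* The two random vectors may live on different probability spaces. *)

definition dcx_le ::
  "nat \<Rightarrow> 'v measure \<Rightarrow> ('v \<Rightarrow> nat \<Rightarrow> real) \<Rightarrow> 'w measure \<Rightarrow> ('w \<Rightarrow> nat \<Rightarrow> real) \<Rightarrow> bool" where
  "dcx_le n M X N Y \<longleftrightarrow>
     (\<forall>f. dcx n f \<longrightarrow> integrable M (\<lambda>\<omega>. f (X \<omega>)) \<longrightarrow> integrable N (\<lambda>\<omega>. f (Y \<omega>))
        \<longrightarrow> (\<integral>\<omega>. f (X \<omega>) \<partial>M) \<le> (\<integral>\<omega>. f (Y \<omega>) \<partial>N))"

(* The measure distr (count_space I) borel X is the sum of the unit masses at the
   points X i, i \<in> I. Points may be repeated; I may be finite or empty. *)

definition point_configs :: "'a::euclidean_space measure set" where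
  "point_configs =
     {N. (\<exists>(I :: nat set) X. N = distr (count_space I) borel X) \<and>
         (\<forall>B \<in> sets borel. bounded B \<longrightarrow> emeasure N B < \<infinity>)}"

(* The sigma-algebra generated by the counts N B, B bounded Borel. *)

definition config_space :: "'a::euclidean_space measure measure" where
  "config_space =
     (SUP B \<in> {B \<in> sets borel. bounded B}.
        vimage_algebra point_configs (\<lambda>N. emeasure N B) borel)"

definition point_process :: "'w measure \<Rightarrow> ('w \<Rightarrow> 'a::euclidean_space measure) \<Rightarrow> bool" where
  "point_process M \<Phi> \<longleftrightarrow> prob_space M \<and> \<Phi> \<in> M \<rightarrow>\<^sub>M config_space"

definition stationary :: "'w measure \<Rightarrow> ('w \<Rightarrow> 'a::euclidean_space measure) \<Rightarrow> bool" where
  "stationary M \<Phi> \<longleftrightarrow>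
     (\<forall>t. distr M config_space (\<lambda>\<omega>. distr (\<Phi> \<omega>) borel (\<lambda>x. x + t)) = distr M config_space \<Phi>)"

definition pp_dcx_le ::
  "'v measure \<Rightarrow> ('v \<Rightarrow> 'a::euclidean_space measure) \<Rightarrow>
   'w measure \<Rightarrow> ('w \<Rightarrow> 'a measure) \<Rightarrow> bool" where
  "pp_dcx_le M \<Phi> N \<Psi> \<longleftrightarrow>
     (\<forall>n\<ge>1. \<forall>A :: nat \<Rightarrow> 'a set. (\<forall>i<n. A i \<in> sets borel \<and> bounded (A i)) \<longrightarrow>
        dcx_le n M (\<lambda>\<omega>. \<lambda>i\<in>{..<n}. measure (\<Phi> \<omega>) (A i))
                 N (\<lambda>\<omega>. \<lambda>i\<in>{..<n}. measure (\<Psi> \<omega>) (A i)))"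

(* B is any bounded Borel set of Lebesgue measure 1; for a stationary process the
   value does not depend on it. *)

definition intensity ::
  "'w measure \<Rightarrow> ('w \<Rightarrow> 'a::euclidean_space measure) \<Rightarrow> 'a set \<Rightarrow> ennreal" where
  "intensity M \<Phi> B = (\<integral>\<^sup>+\<omega>. emeasure (\<Phi> \<omega>) B \<partial>M)"

(* The sum over the points X i \<in> G, with multiplicities, is the integral over G with
   respect to the counting measure; see nn_integral_point_config below. Balls are closed.
   For r \<ge> 0 a point of the configuration lies in its own ball, so the ball has mass at
   least 1 and the ennreal subtraction is not truncated; for r < 0 the value is 0. The value
   may be infinite.
   B is the reference set for the intensity and G the observation window; for a
   stationary process the value depends on neither. *)

definition ripley_K ::
  "'w measure \<Rightarrow> ('w \<Rightarrow> 'a::euclidean_space measure) \<Rightarrow> 'a set \<Rightarrow> 'a set \<Rightarrow> real \<Rightarrow> ennreal" where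
  "ripley_K M \<Phi> B G r =
     (\<integral>\<^sup>+\<omega>. (\<integral>\<^sup>+x\<in>G. (emeasure (\<Phi> \<omega>) (cball x r) - 1) \<partial>\<Phi> \<omega>) \<partial>M)
       / (intensity M \<Phi> B * emeasure lborel G)"

lemma nn_integral_point_config:
  fixes X :: "nat \<Rightarrow> 'a::euclidean_space"
  assumes N: "N = distr (count_space I) borel X"
    and h: "h \<in> borel_measurable borel" and G: "G \<in> sets borel"
  shows "(\<integral>\<^sup>+x\<in>G. h x \<partial>N) = (\<integral>\<^sup>+i. h (X i) \<partial>count_space {i \<in> I. X i \<in> G})"
proof -
  have "(\<integral>\<^sup>+x\<in>G. h x \<partial>N) = (\<integral>\<^sup>+i. h (X i) * indicator G (X i) \<partial>count_space I)"
    unfolding N by (subst nn_integral_distr) (use h G in auto)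
  also have "\<dots> = (\<integral>\<^sup>+i. h (X i) \<partial>count_space {i \<in> I. X i \<in> G})"
    by (subst (1 2) nn_integral_count_space_indicator)
       (auto intro!: nn_integral_cong simp: indicator_def)
  finally show ?thesis .
qed

end

theory Submission
  imports Defs
begin

text \<open>
  For r < 0 all balls are empty and both functions vanish; let r \<ge> 0. Write A(G) for the
  expected sum of \<Phi>(B(X, r)) over the points X of \<Phi> in G. Every point lies in its own
  ball, so the numerator of K(r) is A(G) minus the mean number of points in G, and for
  processes of equal finite intensity the claim becomes A_1(G) \<le> A_2(G) for one common window
  G. A common window can be chosen because stationarity makes A and the mean measure multiples
  of Lebesgue measure (\<open>campbell_proportional_lborel\<close>); this rests only on Tonelli's theorem
  and therefore also covers infinite values.

  Cut G into finitely many pieces Q_i of diameter at most \<delta>, the piece Q_i lying near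
  c_i. The Riemann sum of the products \<Phi>(Q_i) \<Phi>(B(c_i, r + \<delta>/2)) lies between A(G)
  for the radius r and A(G) for the radius r + \<delta>. A sum of products of coordinates is
  directionally convex, so the expected Riemann sums are ordered whenever they are finite, and
  \<delta> \<rightarrow> 0 gives the claim by dominated convergence: closed balls shrink to closed balls
  (\<open>campbell_ball_dcx_le\<close>, \<open>campbell_ball_right_continuous\<close>).

  The order compares only finite expectations, and only first moments are known to be finite.
  If r > 0 and A_2(G) is finite, then pieces smaller than the balls show that the counts of
  \<Phi>_2 have finite second moments (\<open>second_moment_finite\<close>), and these moments dominate those of
  \<Phi>_1: the square is the increasing limit of convex functions of linear growth, which are
  integrable (\<open>second_moment_dcx_le\<close>). If A_2(G) is infinite there is nothing to prove.
  For r = 0 the value A_2(G) may be finite although the second moments are not, since A then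
  measures multiplicities only. There the sums of clipped squares of the \<Phi>(Q_i) replace the
  Riemann sums, first \<delta> \<rightarrow> 0 and then the clipping level tends to infinity
  (\<open>campbell_clip_dcx_le\<close>, \<open>campbell_SUP_clip\<close>).
\<close>

section \<open>Measurability of functionals of a configuration\<close>

lemma space_config_space [simp]: "space config_space = point_configs"
  by (auto simp: config_space_def space_Sup_eq_UN)

lemma measurable_count [measurable]:
  assumes "B \<in> sets borel" "bounded B"
  shows "(\<lambda>N. emeasure N B) \<in> borel_measurable config_space"
  unfolding config_space_def using assms
  by (intro measurable_SUP1[of B] measurable_vimage_algebra1) auto

lemma measurable_config_spaceI:
  assumes "\<And>\<omega>. \<omega> \<in> space M \<Longrightarrow> \<kappa> \<omega> \<in> point_configs"
    and "\<And>B. B \<in> sets borel \<Longrightarrow> bounded B \<Longrightarrow> (\<lambda>\<omega>. emeasure (\<kappa> \<omega>) B) \<in> borel_measurable M"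
  shows "\<kappa> \<in> M \<rightarrow>\<^sub>M config_space"
  unfolding config_space_def using assms
  by (intro measurable_SUP2 measurable_vimage_algebra2) auto

lemma sets_point_config [simp]: "N \<in> point_configs \<Longrightarrow> sets N = sets borel"
  by (auto simp: point_configs_def)

lemma space_point_config [simp]: "N \<in> point_configs \<Longrightarrow> space N = UNIV"
  using sets_eq_imp_space_eq[OF sets_point_config] by fastforce

lemma measurable_point_config [simp]: "N \<in> point_configs \<Longrightarrow> measurable N M = measurable borel M"
  by (intro measurable_cong_sets) auto

lemma count_finite: "N \<in> point_configs \<Longrightarrow> B \<in> sets borel \<Longrightarrow> bounded B \<Longrightarrow> emeasure N B < \<infinity>"
  unfolding point_configs_def by blast

lemma count_eq_measure:
  "N \<in> point_configs \<Longrightarrow> B \<in> sets borel \<Longrightarrow> bounded B \<Longrightarrow> emeasure N B = ennreal (measure N B)"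
  using count_finite[of N B] by (intro emeasure_eq_ennreal_measure) simp

lemma sigma_finite_point_config:
  fixes N :: "'a::euclidean_space measure"
  assumes "N \<in> point_configs"
  shows "sigma_finite_measure N"
proof
  have "\<Union> (range (\<lambda>n::nat. cball 0 (real n) :: 'a set)) = UNIV"
    by (auto intro: real_arch_simple)
  moreover have "emeasure N (cball 0 (real n)) \<noteq> \<infinity>" for n
    using count_finite[OF assms, of "cball 0 (real n)"] by simp
  ultimately show "\<exists>A. countable A \<and> A \<subseteq> sets N \<and> \<Union> A = space N \<and> (\<forall>a\<in>A. emeasure N a \<noteq> \<infinity>)"
    using assms by (intro exI[of _ "range (\<lambda>n::nat. cball 0 (real n))"]) auto
qed

text \<open>
  The configuration restricted to a bounded window has finite mass. Dividing it by one plus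
  its mass yields a kernel into the space of subprobability measures, along which integration preserves
  joint measurability; adding one avoids a division by zero for empty windows.
\<close>

lemma measurable_integral_bounded_window:
  fixes \<kappa> :: "'s \<Rightarrow> 'a::euclidean_space measure"
  assumes \<kappa>: "\<kappa> \<in> S \<rightarrow>\<^sub>M config_space"
    and k [measurable]: "case_prod k \<in> borel_measurable (S \<Otimes>\<^sub>M borel)"
    and B [measurable]: "B \<in> sets borel" "bounded B"
  shows "(\<lambda>s. \<integral>\<^sup>+x\<in>B. k s x \<partial>\<kappa> s) \<in> borel_measurable S"
proof -
  have conf: "\<kappa> s \<in> point_configs" if "s \<in> space S" for s
    using measurable_space[OF \<kappa> that] by simp
  have count: "(\<lambda>s. emeasure (\<kappa> s) A) \<in> borel_measurable S" if "A \<in> sets borel" "bounded A" for A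
    using measurable_compose[OF \<kappa> measurable_count[OF that]] .
  have cB [measurable]: "(\<lambda>s. emeasure (\<kappa> s) B) \<in> borel_measurable S"
    using B by (intro count)
  define \<nu> where "\<nu> s = density (\<kappa> s) (\<lambda>x. indicator B x / (1 + emeasure (\<kappa> s) B))" for s
  have em: "emeasure (\<nu> s) A = emeasure (\<kappa> s) (A \<inter> B) / (1 + emeasure (\<kappa> s) B)"
    if s: "s \<in> space S" and [measurable]: "A \<in> sets borel" for s A
  proof -
    note [measurable_cong] = sets_point_config[OF conf[OF s]]
    have "(\<lambda>x. indicator B x / (1 + emeasure (\<kappa> s) B)) \<in> borel_measurable (\<kappa> s)"
      by measurable
    then have "emeasure (\<nu> s) A = (\<integral>\<^sup>+x. indicator (A \<inter> B) x / (1 + emeasure (\<kappa> s) B) \<partial>\<kappa> s)"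
      unfolding \<nu>_def
      by (subst emeasure_density)
         (auto intro!: nn_integral_cong simp: sets_point_config[OF conf[OF s]] indicator_def)
    then show ?thesis
      by (simp add: nn_integral_divide)
  qed
  have "\<nu> \<in> S \<rightarrow>\<^sub>M subprob_algebra borel"
  proof (rule measurable_subprob_algebra)
    fix s assume s: "s \<in> space S"
    show "sets (\<nu> s) = sets borel" using conf[OF s] by (simp add: \<nu>_def)
    have fin: "emeasure (\<kappa> s) B < \<infinity>" using count_finite conf s B by blast
    show "subprob_space (\<nu> s)"
    proof
      have "emeasure (\<nu> s) (space (\<nu> s)) = emeasure (\<kappa> s) B / (1 + emeasure (\<kappa> s) B)"
        using em[OF s, of UNIV] conf[OF s] by (simp add: \<nu>_def)
      also have "\<dots> \<le> 1"
        using fin by (intro divide_le_posI_ennreal) (auto simp: add_pos_nonneg)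
      finally show "emeasure (\<nu> s) (space (\<nu> s)) \<le> 1" .
      show "space (\<nu> s) \<noteq> {}" using conf[OF s] by (simp add: \<nu>_def)
    qed
  next
    fix A :: "'a set" assume A [measurable]: "A \<in> sets borel"
    have [measurable]: "(\<lambda>s. emeasure (\<kappa> s) (A \<inter> B)) \<in> borel_measurable S"
      using B by (intro count) (auto intro: bounded_subset)
    have "(\<lambda>s. emeasure (\<kappa> s) (A \<inter> B) / (1 + emeasure (\<kappa> s) B)) \<in> borel_measurable S"
      by measurable
    then show "(\<lambda>s. emeasure (\<nu> s) A) \<in> borel_measurable S"
      by (subst measurable_cong) (auto simp: em)
  qed
  from nn_integral_measurable_subprob_algebra2[OF k this]
  have [measurable]: "(\<lambda>s. integral\<^sup>N (\<nu> s) (k s)) \<in> borel_measurable S" .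
  have "(\<lambda>s. (1 + emeasure (\<kappa> s) B) * integral\<^sup>N (\<nu> s) (k s)) \<in> borel_measurable S"
    by measurable
  also have "?this \<longleftrightarrow> (\<lambda>s. \<integral>\<^sup>+x\<in>B. k s x \<partial>\<kappa> s) \<in> borel_measurable S"
  proof (rule measurable_cong)
    fix s assume s: "s \<in> space S"
    note [measurable_cong] = sets_point_config[OF conf[OF s]]
    have [measurable]: "k s \<in> borel_measurable borel" using s by measurable
    let ?c = "1 + emeasure (\<kappa> s) B"
    have fin: "?c < \<infinity>" using count_finite[OF conf[OF s]] B by (simp add: less_top[symmetric])
    have "?c * integral\<^sup>N (\<nu> s) (k s) = (\<integral>\<^sup>+x. ?c * (indicator B x / ?c * k s x) \<partial>\<kappa> s)"
      unfolding \<nu>_def by (simp add: nn_integral_density nn_integral_cmult)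
    also have "\<dots> = (\<integral>\<^sup>+x\<in>B. k s x \<partial>\<kappa> s)"
    proof (rule nn_integral_cong)
      fix x
      have "?c * (1 / ?c) = 1"
        using fin by (simp add: ennreal_times_divide ennreal_divide_self add_pos_nonneg)
      then show "?c * (indicator B x / ?c * k s x) = k s x * indicator B x"
        by (auto simp: indicator_def mult.assoc[symmetric])
    qed
    finally show "?c * integral\<^sup>N (\<nu> s) (k s) = (\<integral>\<^sup>+x\<in>B. k s x \<partial>\<kappa> s)" .
  qed
  finally show ?thesis .
qed

lemma measurable_integral_config:
  fixes \<kappa> :: "'s \<Rightarrow> 'a::euclidean_space measure"
  assumes \<kappa>: "\<kappa> \<in> S \<rightarrow>\<^sub>M config_space"
    and k [measurable]: "case_prod k \<in> borel_measurable (S \<Otimes>\<^sub>M borel)"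
  shows "(\<lambda>s. integral\<^sup>N (\<kappa> s) (k s)) \<in> borel_measurable S"
proof -
  define C where "C n = (cball 0 (real n) :: 'a set)" for n
  have [measurable]: "(\<lambda>s. \<integral>\<^sup>+x\<in>C n. k s x \<partial>\<kappa> s) \<in> borel_measurable S" for n
    by (rule measurable_integral_bounded_window[OF \<kappa> k]) (auto simp: C_def)
  have "(\<lambda>s. SUP n. \<integral>\<^sup>+x\<in>C n. k s x \<partial>\<kappa> s) \<in> borel_measurable S"
    by measurable
  also have "?this \<longleftrightarrow> (\<lambda>s. integral\<^sup>N (\<kappa> s) (k s)) \<in> borel_measurable S"
  proof (rule measurable_cong)
    fix s assume s: "s \<in> space S"
    have conf: "\<kappa> s \<in> point_configs" using measurable_space[OF \<kappa> s] by simp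
    note [measurable_cong] = sets_point_config[OF conf]
    have [measurable]: "k s \<in> borel_measurable borel" using s by measurable
    have "(SUP n. \<integral>\<^sup>+x\<in>C n. k s x \<partial>\<kappa> s) = (\<integral>\<^sup>+x. (SUP n. k s x * indicator (C n) x) \<partial>\<kappa> s)"
      by (rule nn_integral_monotone_convergence_SUP[symmetric])
         (auto simp: C_def incseq_def le_fun_def indicator_def)
    also have "\<dots> = integral\<^sup>N (\<kappa> s) (k s)"
    proof (rule nn_integral_cong)
      fix x :: 'a
      obtain m where "norm x \<le> real m" using real_arch_simple by blast
      then have "x \<in> C m" by (simp add: C_def)
      then show "(SUP n. k s x * indicator (C n) x) = k s x"
        by (intro antisym SUP_least SUP_upper2[of m]) (auto simp: indicator_def)
    qed
    finally show "(SUP n. \<integral>\<^sup>+x\<in>C n. k s x \<partial>\<kappa> s) = integral\<^sup>N (\<kappa> s) (k s)" .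
  qed
  finally show ?thesis .
qed

text \<open>
  The count of a ball with a moving centre is an integral over the configuration, hence jointly
  measurable in the configuration and the centre.
\<close>

lemma measurable_ball_count [measurable]:
  "(\<lambda>(N, x :: 'a::euclidean_space). emeasure N (cball x r)) \<in> borel_measurable (config_space \<Otimes>\<^sub>M borel)"
proof -
  have "(\<lambda>p. \<integral>\<^sup>+y. indicator {y. dist (snd p) y \<le> r} y \<partial>fst p)
      \<in> borel_measurable (config_space \<Otimes>\<^sub>M (borel :: 'a measure))"
  proof (rule measurable_integral_config)
    have "(\<lambda>q :: ('a measure \<times> 'a) \<times> 'a. if dist (snd (fst q)) (snd q) \<le> r then 1 else 0 :: ennreal)
        \<in> borel_measurable ((config_space \<Otimes>\<^sub>M borel) \<Otimes>\<^sub>M borel)"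
      by measurable
    then show "(\<lambda>(p, y). indicator {y. dist (snd p) y \<le> r} y)
        \<in> borel_measurable ((config_space \<Otimes>\<^sub>M borel) \<Otimes>\<^sub>M (borel :: 'a measure))"
      by (simp add: indicator_def of_bool_def case_prod_beta)
  qed simp
  also have "?this \<longleftrightarrow> ?thesis"
    by (rule measurable_cong) (auto simp: space_pair_measure cball_def[symmetric])
  finally show ?thesis .
qed

section \<open>Campbell measures of stationary processes\<close>

text \<open>
  The Campbell measure of \<Phi> with weight h. The intensity and the numerator of Ripley's function
  are instances, so that the translation argument serves both.
\<close>

definition campbell ::
  "'w measure \<Rightarrow> ('w \<Rightarrow> 'a::euclidean_space measure) \<Rightarrow> ('a measure \<Rightarrow> 'a \<Rightarrow> ennreal) \<Rightarrow> 'a set \<Rightarrow> ennreal"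
  where "campbell M \<Phi> h G = (\<integral>\<^sup>+\<omega>. (\<integral>\<^sup>+x\<in>G. h (\<Phi> \<omega>) x \<partial>\<Phi> \<omega>) \<partial>M)"

abbreviation shift :: "'a::euclidean_space \<Rightarrow> 'a measure \<Rightarrow> 'a measure"
  where "shift t N \<equiv> distr N borel (\<lambda>x. x + t)"

lemma bounded_borel_preimage_shift:
  fixes B :: "'a::euclidean_space set"
  assumes "B \<in> sets borel" "bounded B"
  shows "(\<lambda>x. x + t) -` B \<in> sets borel" "bounded ((\<lambda>x. x + t) -` B)"
proof -
  show "(\<lambda>x. x + t) -` B \<in> sets borel"
    using measurable_sets[of "\<lambda>x. x + t" borel borel B] assms by simp
  have "(\<lambda>x. x + t) -` B = (\<lambda>x. x - t) ` B" by force
  then show "bounded ((\<lambda>x. x + t) -` B)"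
    using bounded_translation_minus[OF assms(2)] by simp
qed

lemma shift_point_config:
  assumes "N \<in> point_configs"
  shows "shift t N \<in> point_configs"
proof -
  from assms obtain I X where N: "N = distr (count_space I) borel (X :: nat \<Rightarrow> 'a)"
    unfolding point_configs_def by blast
  have "shift t N = distr (count_space I) borel (\<lambda>i. X i + t)"
    unfolding N by (subst distr_distr) (auto simp: comp_def)
  moreover have "emeasure (shift t N) B < \<infinity>" if B: "B \<in> sets borel" "bounded B" for B
  proof -
    show ?thesis
      using count_finite[OF assms bounded_borel_preimage_shift[OF B]] B assms by (simp add: emeasure_distr)
  qed
  ultimately show ?thesis
    unfolding point_configs_def by blast
qed

lemma measurable_shift: "shift t \<in> config_space \<rightarrow>\<^sub>M config_space"
proof (rule measurable_config_spaceI)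
  fix B :: "'a set" assume B: "B \<in> sets borel" "bounded B"
  show "(\<lambda>N. emeasure (shift t N) B) \<in> borel_measurable config_space"
    using measurable_count[OF bounded_borel_preimage_shift[OF B]] B
    by (subst measurable_cong) (auto simp: emeasure_distr)
qed (simp add: shift_point_config)

text \<open>
  Moving the window by -t amounts to moving the process by t because the mark h moves along
  with the configuration; stationarity then removes the motion of the process.
\<close>

lemma campbell_stationary:
  fixes \<Phi> :: "'w \<Rightarrow> 'a::euclidean_space measure"
  assumes \<Phi>: "\<Phi> \<in> M \<rightarrow>\<^sub>M config_space" and st: "stationary M \<Phi>"
    and h [measurable]: "case_prod h \<in> borel_measurable (config_space \<Otimes>\<^sub>M borel)"
    and inv: "\<And>N x. N \<in> point_configs \<Longrightarrow> h (shift t N) (x + t) = h N x"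
    and G [measurable]: "G \<in> sets borel"
  shows "campbell M \<Phi> h {x. x + t \<in> G} = campbell M \<Phi> h G"
proof -
  define F where "F N = (\<integral>\<^sup>+x\<in>G. h N x \<partial>N)" for N
  have F: "F \<in> borel_measurable config_space"
    unfolding F_def by (rule measurable_integral_config) measurable
  have S: "(\<lambda>\<omega>. shift t (\<Phi> \<omega>)) \<in> M \<rightarrow>\<^sub>M config_space"
    by (rule measurable_compose[OF \<Phi> measurable_shift])
  have "campbell M \<Phi> h G = (\<integral>\<^sup>+N. F N \<partial>distr M config_space \<Phi>)"
    using \<Phi> F by (simp add: campbell_def F_def[symmetric] nn_integral_distr)
  also have "distr M config_space \<Phi> = distr M config_space (\<lambda>\<omega>. shift t (\<Phi> \<omega>))"
    using st by (simp add: stationary_def)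
  also have "(\<integral>\<^sup>+N. F N \<partial>\<dots>) = (\<integral>\<^sup>+\<omega>. F (shift t (\<Phi> \<omega>)) \<partial>M)"
    using S F by (simp add: nn_integral_distr)
  also have "\<dots> = campbell M \<Phi> h {x. x + t \<in> G}"
    unfolding campbell_def
  proof (rule nn_integral_cong)
    fix \<omega> assume "\<omega> \<in> space M"
    then have conf: "\<Phi> \<omega> \<in> point_configs" using measurable_space[OF \<Phi>] by simp
    have sc: "shift t (\<Phi> \<omega>) \<in> space config_space" using shift_point_config[OF conf] by simp
    have [measurable]: "h (shift t (\<Phi> \<omega>)) \<in> borel_measurable borel"
      using measurable_compose[OF measurable_Pair1'[OF sc] h] by simp
    have "F (shift t (\<Phi> \<omega>)) = (\<integral>\<^sup>+x. h (shift t (\<Phi> \<omega>)) (x + t) * indicator G (x + t) \<partial>\<Phi> \<omega>)"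
      unfolding F_def using conf by (subst nn_integral_distr) simp_all
    then show "F (shift t (\<Phi> \<omega>)) = (\<integral>\<^sup>+x\<in>{x. x + t \<in> G}. h (\<Phi> \<omega>) x \<partial>\<Phi> \<omega>)"
      by (simp add: inv[OF conf] indicator_def)
  qed
  finally show ?thesis by simp
qed

lemma campbell_Tonelli:
  fixes \<Phi> :: "'w \<Rightarrow> 'a::euclidean_space measure" and u :: "'a \<Rightarrow> 'a \<Rightarrow> ennreal"
  assumes M: "prob_space M" and \<Phi> [measurable]: "\<Phi> \<in> M \<rightarrow>\<^sub>M config_space"
    and h [measurable]: "case_prod h \<in> borel_measurable (config_space \<Otimes>\<^sub>M borel)"
    and u [measurable]: "case_prod u \<in> borel_measurable (borel \<Otimes>\<^sub>M borel)"
  shows "(\<integral>\<^sup>+t. (\<integral>\<^sup>+\<omega>. (\<integral>\<^sup>+x. h (\<Phi> \<omega>) x * u t x \<partial>\<Phi> \<omega>) \<partial>M) \<partial>lborel) =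
         (\<integral>\<^sup>+\<omega>. (\<integral>\<^sup>+x. h (\<Phi> \<omega>) x * (\<integral>\<^sup>+t. u t x \<partial>lborel) \<partial>\<Phi> \<omega>) \<partial>M)"
proof -
  interpret prob_space M by (rule M)
  interpret P: pair_sigma_finite M "lborel :: 'a measure" ..
  have h2 [measurable]: "case_prod (\<lambda>\<omega> x. h (\<Phi> \<omega>) x) \<in> borel_measurable (M \<Otimes>\<^sub>M borel)"
    using measurable_compose[OF _ h, of "\<lambda>(\<omega>, x). (\<Phi> \<omega>, x)"] by (simp add: case_prod_beta)
  have "case_prod (\<lambda>\<omega> t. \<integral>\<^sup>+x. h (\<Phi> \<omega>) x * u t x \<partial>\<Phi> \<omega>) \<in> borel_measurable (M \<Otimes>\<^sub>M lborel)"
    unfolding case_prod_beta by (rule measurable_integral_config) measurable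
  then have "(\<integral>\<^sup>+t. (\<integral>\<^sup>+\<omega>. (\<integral>\<^sup>+x. h (\<Phi> \<omega>) x * u t x \<partial>\<Phi> \<omega>) \<partial>M) \<partial>lborel) =
             (\<integral>\<^sup>+\<omega>. (\<integral>\<^sup>+t. (\<integral>\<^sup>+x. h (\<Phi> \<omega>) x * u t x \<partial>\<Phi> \<omega>) \<partial>lborel) \<partial>M)"
    by (rule P.Fubini')
  also have "\<dots> = (\<integral>\<^sup>+\<omega>. (\<integral>\<^sup>+x. h (\<Phi> \<omega>) x * (\<integral>\<^sup>+t. u t x \<partial>lborel) \<partial>\<Phi> \<omega>) \<partial>M)"
  proof (rule nn_integral_cong)
    fix \<omega> assume \<omega>: "\<omega> \<in> space M"
    have conf: "\<Phi> \<omega> \<in> point_configs" using measurable_space[OF \<Phi> \<omega>] by simp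
    interpret N: sigma_finite_measure "\<Phi> \<omega>" by (rule sigma_finite_point_config[OF conf])
    interpret Q: pair_sigma_finite "\<Phi> \<omega>" "lborel :: 'a measure" ..
    have [measurable]: "h (\<Phi> \<omega>) \<in> borel_measurable borel"
      using measurable_compose[OF measurable_Pair1'[OF \<omega>] h2] by simp
    have "case_prod (\<lambda>x t. h (\<Phi> \<omega>) x * u t x) \<in> borel_measurable (borel \<Otimes>\<^sub>M borel)"
      by measurable
    also have "borel_measurable (borel \<Otimes>\<^sub>M borel :: ('a \<times> 'a) measure) = borel_measurable (\<Phi> \<omega> \<Otimes>\<^sub>M lborel)"
      using conf by (intro measurable_cong_sets sets_pair_measure_cong) auto
    finally have "(\<integral>\<^sup>+t. (\<integral>\<^sup>+x. h (\<Phi> \<omega>) x * u t x \<partial>\<Phi> \<omega>) \<partial>lborel) =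
                  (\<integral>\<^sup>+x. (\<integral>\<^sup>+t. h (\<Phi> \<omega>) x * u t x \<partial>lborel) \<partial>\<Phi> \<omega>)"
      by (rule Q.Fubini')
    then show "(\<integral>\<^sup>+t. (\<integral>\<^sup>+x. h (\<Phi> \<omega>) x * u t x \<partial>\<Phi> \<omega>) \<partial>lborel) =
               (\<integral>\<^sup>+x. h (\<Phi> \<omega>) x * (\<integral>\<^sup>+t. u t x \<partial>lborel) \<partial>\<Phi> \<omega>)"
      by (simp add: nn_integral_cmult)
  qed
  finally show ?thesis .
qed

lemma nn_integral_lborel_reflect:
  fixes f :: "'a::euclidean_space \<Rightarrow> ennreal"
  assumes [measurable]: "f \<in> borel_measurable borel"
  shows "(\<integral>\<^sup>+t. f (x - t) \<partial>lborel) = (\<integral>\<^sup>+s. f s \<partial>lborel)"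
proof -
  have "(lborel :: 'a measure) = distr lborel borel (\<lambda>t. x - t)"
    using lborel_affine[of "-1" x] by (simp add: density_1)
  then have "(\<integral>\<^sup>+s. f s \<partial>lborel) = (\<integral>\<^sup>+s. f s \<partial>distr lborel borel (\<lambda>t. x - t))"
    by simp
  then show ?thesis by (simp add: nn_integral_distr)
qed

text \<open>
  A translation-invariant measure is a multiple of Lebesgue measure. The classical argument averages
  over translations: each side is the Campbell integral of a convolution of the two indicator
  functions, and convolution is symmetric. The value infinity is included: a Campbell measure that is finite on
  one set of positive volume is finite on all bounded sets.
\<close>

lemma campbell_proportional_lborel:
  fixes \<Phi> :: "'w \<Rightarrow> 'a::euclidean_space measure"
  assumes pp: "point_process M \<Phi>" and st: "stationary M \<Phi>"
    and h [measurable]: "case_prod h \<in> borel_measurable (config_space \<Otimes>\<^sub>M borel)"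
    and inv: "\<And>t N x. N \<in> point_configs \<Longrightarrow> h (shift t N) (x + t) = h N x"
    and G [measurable]: "G \<in> sets borel" and H [measurable]: "H \<in> sets borel"
  shows "campbell M \<Phi> h G * emeasure lborel H = campbell M \<Phi> h H * emeasure lborel G"
proof -
  have M: "prob_space M" and \<Phi>: "\<Phi> \<in> M \<rightarrow>\<^sub>M config_space"
    using pp by (auto simp: point_process_def)
  \<comment> \<open>The factor |B| is spent on averaging over the translations of A by t \<in> B.\<close>
  have averaged: "campbell M \<Phi> h A * emeasure lborel B =
      (\<integral>\<^sup>+\<omega>. (\<integral>\<^sup>+x. h (\<Phi> \<omega>) x * (\<integral>\<^sup>+t. indicator A (x - t) * indicator B t \<partial>lborel) \<partial>\<Phi> \<omega>) \<partial>M)"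
    if [measurable]: "A \<in> sets borel" "B \<in> sets borel" for A B
  proof -
    have "campbell M \<Phi> h A * emeasure lborel B = (\<integral>\<^sup>+t. campbell M \<Phi> h A * indicator B t \<partial>lborel)"
      by (simp add: nn_integral_cmult)
    also have "\<dots> = (\<integral>\<^sup>+t. (\<integral>\<^sup>+\<omega>. (\<integral>\<^sup>+x. h (\<Phi> \<omega>) x * (indicator A (x - t) * indicator B t) \<partial>\<Phi> \<omega>) \<partial>M) \<partial>lborel)"
    proof (rule nn_integral_cong)
      fix t :: 'a
      have "campbell M \<Phi> h A = campbell M \<Phi> h {x. x - t \<in> A}"
        using campbell_stationary[OF \<Phi> st h inv, of A "- t"] by simp
      then show "campbell M \<Phi> h A * indicator B t =
          (\<integral>\<^sup>+\<omega>. (\<integral>\<^sup>+x. h (\<Phi> \<omega>) x * (indicator A (x - t) * indicator B t) \<partial>\<Phi> \<omega>) \<partial>M)"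
        by (simp add: campbell_def indicator_def)
    qed
    also have "\<dots> = (\<integral>\<^sup>+\<omega>. (\<integral>\<^sup>+x. h (\<Phi> \<omega>) x * (\<integral>\<^sup>+t. indicator A (x - t) * indicator B t \<partial>lborel) \<partial>\<Phi> \<omega>) \<partial>M)"
      by (rule campbell_Tonelli[OF M \<Phi> h]) measurable
    finally show ?thesis .
  qed
  have "(\<integral>\<^sup>+t. indicator G (x - t) * indicator H t \<partial>lborel) =
        (\<integral>\<^sup>+t. indicator H (x - t) * indicator G t \<partial>lborel)" for x
    using nn_integral_lborel_reflect[of "\<lambda>t. indicator G (x - t) * indicator H t" x]
    by (simp add: mult.commute)
  then show ?thesis
    by (simp add: averaged G H)
qed

section \<open>Directionally convex functions\<close>

lemma dcxD:
  assumes "dcx n f" "x \<in> {..<n} \<rightarrow>\<^sub>E UNIV" "y \<in> {..<n} \<rightarrow>\<^sub>E UNIV"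
    "p \<in> {..<n} \<rightarrow>\<^sub>E UNIV" "q \<in> {..<n} \<rightarrow>\<^sub>E UNIV"
    and "\<forall>i<n. p i \<le> x i \<and> x i \<le> q i \<and> p i \<le> y i \<and> y i \<le> q i \<and> x i + y i = p i + q i"
  shows "f x + f y \<le> f p + f q"
  using assms(1)[unfolded dcx_def, rule_format, OF assms(2-5)] assms(6) by simp

lemma dcx_sum:
  assumes "\<And>s. s \<in> S \<Longrightarrow> dcx n (f s)"
  shows "dcx n (\<lambda>v. \<Sum>s\<in>S. f s v)"
  unfolding dcx_def
proof (intro ballI impI)
  fix x y p q :: "nat \<Rightarrow> real"
  assume "x \<in> {..<n} \<rightarrow>\<^sub>E UNIV" "y \<in> {..<n} \<rightarrow>\<^sub>E UNIV" "p \<in> {..<n} \<rightarrow>\<^sub>E UNIV" "q \<in> {..<n} \<rightarrow>\<^sub>E UNIV"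
    and "\<forall>i<n. p i \<le> x i \<and> x i \<le> q i \<and> p i \<le> y i \<and> y i \<le> q i \<and> x i + y i = p i + q i"
  from dcxD[OF assms this] have "f s x + f s y \<le> f s p + f s q" if "s \<in> S" for s
    using that .
  then show "(\<Sum>s\<in>S. f s x) + (\<Sum>s\<in>S. f s y) \<le> (\<Sum>s\<in>S. f s p) + (\<Sum>s\<in>S. f s q)"
    unfolding sum.distrib[symmetric] by (intro sum_mono)
qed

text \<open>
  With a = x - p and b = y - p, hence q = p + a + b, the defect p_i p_j + q_i q_j - x_i x_j -
  y_i y_j equals a_i b_j + b_i a_j.
\<close>

lemma dcx_mult:
  assumes "i < n" "j < n"
  shows "dcx n (\<lambda>v. v i * v j)"
  unfolding dcx_def
proof (intro ballI impI)
  fix x y p q :: "nat \<Rightarrow> real"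
  assume le: "\<forall>i<n. p i \<le> x i \<and> x i \<le> q i \<and> p i \<le> y i \<and> y i \<le> q i \<and> x i + y i = p i + q i"
  have y: "y i = p i + q i - x i" "y j = p j + q j - x j"
    using le[rule_format, OF assms(1)] le[rule_format, OF assms(2)] by linarith+
  have "p i * p j + q i * q j - x i * x j - y i * y j =
      (x i - p i) * (q j - x j) + (q i - x i) * (x j - p j)"
    unfolding y by (simp add: algebra_simps)
  also have "\<dots> \<ge> 0"
    using le assms by (intro add_nonneg_nonneg mult_nonneg_nonneg) auto
  finally show "x i * x j + y i * y j \<le> p i * p j + q i * q j" by simp
qed

text \<open>
  For k > 0 the clipped square u \<mapsto> u * clip_slope k u is the square, continued beyond k by its
  tangent at k. Its quotient by u is written without division by u, so that continuity at zero
  is evident: it is u up to k and 2k - k^2/u beyond.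
\<close>

definition clip_slope :: "real \<Rightarrow> real \<Rightarrow> real" where
  "clip_slope k u = min u k * (2 - k / max u k)"

lemma clip_slope_small: "0 < k \<Longrightarrow> u \<le> k \<Longrightarrow> clip_slope k u = u"
  by (simp add: clip_slope_def)

lemma clip_slope_large: "0 < k \<Longrightarrow> k < u \<Longrightarrow> u * clip_slope k u = 2 * k * u - k\<^sup>2"
  by (simp add: clip_slope_def field_simps power2_eq_square)

lemma clip_ratio: "0 < k \<Longrightarrow> 0 \<le> k / max u k" "0 < k \<Longrightarrow> k / max u (k::real) \<le> 1"
  by (auto simp: max_def divide_le_eq)

lemma clip_slope_nonneg: "0 < k \<Longrightarrow> 0 \<le> u \<Longrightarrow> 0 \<le> clip_slope k u"
  unfolding clip_slope_def using clip_ratio[of k u] by (intro mult_nonneg_nonneg) (linarith | simp)+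

lemma clip_slope_mono:
  assumes "0 < k" "0 \<le> u" "u \<le> v"
  shows "clip_slope k u \<le> clip_slope k v"
proof -
  have "k / max v k \<le> k / max u k"
    using assms by (intro divide_left_mono) (auto simp: max_def)
  then show ?thesis
    unfolding clip_slope_def using assms clip_ratio[of k u] by (intro mult_mono) (linarith | simp)+
qed

lemma clip_slope_le_bound: "0 < k \<Longrightarrow> 0 \<le> u \<Longrightarrow> clip_slope k u \<le> 2 * k"
  unfolding clip_slope_def mult.commute[of 2 k] using clip_ratio[of k u] by (intro mult_mono) (linarith | simp)+

lemma continuous_clip_slope: "0 < k \<Longrightarrow> continuous_on UNIV (clip_slope k)"
  unfolding clip_slope_def by (intro continuous_intros) (auto simp: max_def)

text \<open>
  The clipped square is the supremum of those tangents of the square that touch it at a point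
  a \<le> k. Convexity and monotonicity in the level k both follow from this description.
\<close>

lemma clip_square_tangent:
  assumes "0 < k" "a \<le> k"
  shows "2 * a * u - a\<^sup>2 \<le> u * clip_slope k u"
proof (cases "u \<le> k")
  case True
  have "0 \<le> (u - a)\<^sup>2" by simp
  then show ?thesis using True assms by (simp add: clip_slope_small power2_eq_square algebra_simps)
next
  case False
  have "0 \<le> (k - a) * (2 * u - k - a)"
    using False assms by (intro mult_nonneg_nonneg) auto
  then show ?thesis using False assms by (simp add: clip_slope_large power2_eq_square algebra_simps)
qed

lemma clip_square_eq_tangent:
  "0 < k \<Longrightarrow> u * clip_slope k u = 2 * min u k * u - (min u k)\<^sup>2"
  by (cases "u \<le> k") (auto simp: clip_slope_small clip_slope_large power2_eq_square min_def)

lemma clip_slope_mono_level: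
  assumes "0 < k" "k \<le> l" "0 \<le> u"
  shows "clip_slope k u \<le> clip_slope l u"
proof (cases "u = 0")
  case True
  then show ?thesis using assms by (simp add: clip_slope_small)
next
  case False
  have "u * clip_slope k u \<le> u * clip_slope l u"
    unfolding clip_square_eq_tangent[OF assms(1), of u]
    using assms by (intro clip_square_tangent) auto
  then show ?thesis using False assms by simp
qed

lemma clip_slope_le: "0 < k \<Longrightarrow> 0 \<le> u \<Longrightarrow> clip_slope k u \<le> u"
  using clip_slope_mono_level[of k "max u k" u] clip_slope_small[of "max u k" u] by simp

text \<open>
  For a function of one coordinate, directional convexity is convexity: the tangents chosen at
  x and y bound the clipped square from below at p and q.
\<close>

lemma dcx_clip_square:
  assumes "i < n" "0 < k"
  shows "dcx n (\<lambda>v. v i * clip_slope k (v i))"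
proof -
  have convex: "x * clip_slope k x + y * clip_slope k y \<le> p * clip_slope k p + q * clip_slope k q"
    if "p \<le> x" "x \<le> y" "y \<le> q" "x + y = p + q" for x y p q
  proof -
    \<comment> \<open>The points of contact of the tangents that are exact at x and at y.\<close>
    define a where "a = min x k"
    define b where "b = min y k"
    have ab: "a \<le> b" "a \<le> k" "b \<le> k" using that by (auto simp: a_def b_def)
    have "(b - a) * (x - p) \<ge> 0" using ab that by (intro mult_nonneg_nonneg) auto
    moreover have q: "q = x + y - p" using that by simp
    ultimately have "(2 * a * x - a\<^sup>2) + (2 * b * y - b\<^sup>2) \<le> (2 * a * p - a\<^sup>2) + (2 * b * q - b\<^sup>2)"
      unfolding q by (simp add: algebra_simps)
    also have "\<dots> \<le> p * clip_slope k p + q * clip_slope k q"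
      using ab assms by (intro add_mono clip_square_tangent)
    finally show ?thesis
      using clip_square_eq_tangent[OF assms(2)] by (simp add: a_def b_def)
  qed
  show ?thesis
    unfolding dcx_def
  proof (intro ballI impI)
    fix x y p q :: "nat \<Rightarrow> real"
    assume "\<forall>i<n. p i \<le> x i \<and> x i \<le> q i \<and> p i \<le> y i \<and> y i \<le> q i \<and> x i + y i = p i + q i"
    with assms have *: "p i \<le> x i" "x i \<le> q i" "p i \<le> y i" "y i \<le> q i" "x i + y i = p i + q i"
      by blast+
    show "x i * clip_slope k (x i) + y i * clip_slope k (y i)
        \<le> p i * clip_slope k (p i) + q i * clip_slope k (q i)"
      using convex[of "p i" "x i" "y i" "q i"] convex[of "p i" "y i" "x i" "q i"] *
      by (cases "x i \<le> y i") (auto simp: algebra_simps)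
  qed
qed

section \<open>Expectations of functions of the counts\<close>

lemma measurable_count_process:
  assumes "\<Phi> \<in> M \<rightarrow>\<^sub>M config_space" "B \<in> sets borel" "bounded B"
  shows "(\<lambda>\<omega>. emeasure (\<Phi> \<omega>) B) \<in> borel_measurable M" "(\<lambda>\<omega>. measure (\<Phi> \<omega>) B) \<in> borel_measurable M"
proof -
  show "(\<lambda>\<omega>. emeasure (\<Phi> \<omega>) B) \<in> borel_measurable M"
    using measurable_compose[OF assms(1) measurable_count[OF assms(2,3)]] .
  then show "(\<lambda>\<omega>. measure (\<Phi> \<omega>) B) \<in> borel_measurable M"
    unfolding measure_def by measurable
qed

text \<open>
  The order is stated with Bochner integrals, which require integrability; for functions that are
  nonnegative on count vectors a finite nonnegative integral is enough.
\<close>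

lemma dcx_expectation_le:
  fixes \<Phi>\<^sub>1 :: "'v \<Rightarrow> 'a::euclidean_space measure" and \<Phi>\<^sub>2 :: "'w \<Rightarrow> 'a measure"
  defines "counts A n N \<equiv> (\<lambda>i\<in>{..<n}. measure N (A i))"
  assumes "\<Phi>\<^sub>1 \<in> M\<^sub>1 \<rightarrow>\<^sub>M config_space" "\<Phi>\<^sub>2 \<in> M\<^sub>2 \<rightarrow>\<^sub>M config_space" and le: "pp_dcx_le M\<^sub>1 \<Phi>\<^sub>1 M\<^sub>2 \<Phi>\<^sub>2"
    and n: "0 < n" and A: "\<And>i. i < n \<Longrightarrow> A i \<in> sets borel" "\<And>i. i < n \<Longrightarrow> bounded (A i)"
    and f: "dcx n f" "f \<in> borel_measurable (PiM {..<n} (\<lambda>_. borel))"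
    and nonneg: "\<And>v. (\<And>i. i < n \<Longrightarrow> 0 \<le> v i) \<Longrightarrow> 0 \<le> f v"
    and fin: "(\<integral>\<^sup>+\<omega>. f (counts A n (\<Phi>\<^sub>1 \<omega>)) \<partial>M\<^sub>1) < \<infinity>" "(\<integral>\<^sup>+\<omega>. f (counts A n (\<Phi>\<^sub>2 \<omega>)) \<partial>M\<^sub>2) < \<infinity>"
  shows "(\<integral>\<^sup>+\<omega>. f (counts A n (\<Phi>\<^sub>1 \<omega>)) \<partial>M\<^sub>1) \<le> (\<integral>\<^sup>+\<omega>. f (counts A n (\<Phi>\<^sub>2 \<omega>)) \<partial>M\<^sub>2)"
proof -
  have meas: "(\<lambda>\<omega>. f (counts A n (\<Phi> \<omega>))) \<in> borel_measurable M"
    if "\<Phi> \<in> M \<rightarrow>\<^sub>M config_space" for M :: "'x measure" and \<Phi>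
  proof (rule measurable_compose[OF _ f(2)])
    show "(\<lambda>\<omega>. counts A n (\<Phi> \<omega>)) \<in> M \<rightarrow>\<^sub>M PiM {..<n} (\<lambda>_. borel)"
      unfolding counts_def using that A by (intro measurable_restrict measurable_count_process) auto
  qed
  have pos: "0 \<le> f (counts A n N)" for N
    by (rule nonneg) (simp add: counts_def)
  have int: "integrable M\<^sub>1 (\<lambda>\<omega>. f (counts A n (\<Phi>\<^sub>1 \<omega>)))" "integrable M\<^sub>2 (\<lambda>\<omega>. f (counts A n (\<Phi>\<^sub>2 \<omega>)))"
    using fin pos meas assms by (auto intro!: integrableI_nonneg)
  then have "(\<integral>\<omega>. f (counts A n (\<Phi>\<^sub>1 \<omega>)) \<partial>M\<^sub>1) \<le> (\<integral>\<omega>. f (counts A n (\<Phi>\<^sub>2 \<omega>)) \<partial>M\<^sub>2)"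
    using le n A f(1) unfolding pp_dcx_le_def dcx_le_def counts_def by (auto simp: Suc_le_eq)
  then show ?thesis
    using int pos by (simp add: nn_integral_eq_integral)
qed

section \<open>Partitions and Riemann sums\<close>

lemma bounded_borel_partition:
  fixes G :: "'a::euclidean_space set"
  assumes G: "G \<in> sets borel" "bounded G" "G \<noteq> {}" and \<delta>: "0 < \<delta>"
  obtains n Q c where "0 < (n::nat)" "disjoint_family_on Q {..<n}" "(\<Union>i<n. Q i) = G"
    "\<And>i. Q i \<in> sets borel" "\<And>i. Q i \<subseteq> cball (c i) \<delta>" "\<And>i. bounded (Q i)"
proof -
  have "compact (closure G)" using G by simp
  then obtain C where C: "finite C" "closure G \<subseteq> (\<Union>x\<in>C. ball x \<delta>)"
    unfolding compact_eq_totally_bounded using \<delta> by metis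
  obtain c where c: "bij_betw c {0..<card C} C"
    using ex_bij_betw_nat_finite[OF C(1)] by blast
  define n where "n = card C"
  define Q where "Q i = G \<inter> ball (c i) \<delta> - (\<Union>j<i. ball (c j) \<delta>)" for i :: nat
  have "C = c ` {..<n}"
    using c by (simp add: bij_betw_def n_def lessThan_atLeast0)
  then have "(\<Union>x\<in>C. ball x \<delta>) = (\<Union>i<n. ball (c i) \<delta>)"
    by (simp only: image_image)
  then have cover: "G \<subseteq> (\<Union>i<n. ball (c i) \<delta>)"
    using order_trans[OF closure_subset C(2)] by simp
  show ?thesis
  proof
    show "0 < n" using cover G(3) by (cases n) auto
    show "disjoint_family_on Q {..<n}"
      unfolding disjoint_family_on_def
    proof (intro ballI impI)
      fix i j :: nat assume "i \<noteq> j"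
      then consider "i < j" | "j < i" by linarith
      then show "Q i \<inter> Q j = {}"
        by cases (auto simp: Q_def)
    qed
    show "(\<Union>i<n. Q i) = G"
    proof
      show "G \<subseteq> (\<Union>i<n. Q i)"
      proof
        fix x assume x: "x \<in> G"
        define i where "i = (LEAST i. x \<in> ball (c i) \<delta>)"
        obtain j where j: "j < n" "x \<in> ball (c j) \<delta>" using cover x by blast
        have "x \<in> ball (c i) \<delta>" "i \<le> j"
          unfolding i_def using j by (auto intro: LeastI Least_le simp del: mem_ball)
        moreover have "x \<notin> ball (c m) \<delta>" if "m < i" for m
          using not_less_Least that unfolding i_def by blast
        ultimately show "x \<in> (\<Union>i<n. Q i)" using x j by (auto simp: Q_def intro!: bexI[of _ i])
      qed
    qed (auto simp: Q_def)
    show "Q i \<in> sets borel" for i using G by (auto simp: Q_def)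
    show "Q i \<subseteq> cball (c i) \<delta>" for i by (auto simp: Q_def)
    show "bounded (Q i)" for i using G(2) by (rule bounded_subset) (auto simp: Q_def)
  qed
qed

text \<open>
  Both inequalities compare an integrand with the step function that is constant on the pieces.
\<close>

lemma partition_sum_bounds:
  fixes b :: "nat \<Rightarrow> ennreal"
  assumes disj: "disjoint_family_on Q {..<n}" and Q: "\<And>i. Q i \<in> sets N" and G: "(\<Union>i<n. Q i) = G"
  shows "(\<And>i x. i < n \<Longrightarrow> x \<in> Q i \<Longrightarrow> u x \<le> b i) \<Longrightarrow> (\<integral>\<^sup>+x\<in>G. u x \<partial>N) \<le> (\<Sum>i<n. b i * emeasure N (Q i))"
    and "(\<And>i x. i < n \<Longrightarrow> x \<in> Q i \<Longrightarrow> b i \<le> u x) \<Longrightarrow> (\<Sum>i<n. b i * emeasure N (Q i)) \<le> (\<integral>\<^sup>+x\<in>G. u x \<partial>N)"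
proof -
  have sum: "(\<Sum>i<n. b i * emeasure N (Q i)) = (\<integral>\<^sup>+x. (\<Sum>i<n. b i * indicator (Q i) x) \<partial>N)"
    using Q by (subst nn_integral_sum) (auto simp: nn_integral_cmult_indicator)
  have step: "(\<Sum>i<n. b i * indicator (Q i) x) = b j" if "j < n" "x \<in> Q j" for j x
  proof -
    have "(\<Sum>i<n. b i * indicator (Q i) x) = (\<Sum>i<n. if i = j then b i else 0)"
      using disj that by (intro sum.cong) (auto simp: indicator_def disjoint_family_on_def)
    then show ?thesis using that by simp
  qed
  have cases: "(\<exists>j<n. x \<in> Q j \<and> x \<in> G) \<or> (x \<notin> G \<and> (\<forall>i<n. x \<notin> Q i))" for x
    using G by auto
  show "(\<integral>\<^sup>+x\<in>G. u x \<partial>N) \<le> (\<Sum>i<n. b i * emeasure N (Q i))"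
    if le: "\<And>i x. i < n \<Longrightarrow> x \<in> Q i \<Longrightarrow> u x \<le> b i"
    unfolding sum
  proof (rule nn_integral_mono)
    fix x
    show "u x * indicator G x \<le> (\<Sum>i<n. b i * indicator (Q i) x)"
      using cases[of x] le step by (auto simp: indicator_def simp del: sum_mult_of_bool_eq)
  qed
  show "(\<Sum>i<n. b i * emeasure N (Q i)) \<le> (\<integral>\<^sup>+x\<in>G. u x \<partial>N)"
    if le: "\<And>i x. i < n \<Longrightarrow> x \<in> Q i \<Longrightarrow> b i \<le> u x"
    unfolding sum
  proof (rule nn_integral_mono)
    fix x
    show "(\<Sum>i<n. b i * indicator (Q i) x) \<le> u x * indicator G x"
      using cases[of x] le step by (auto simp: indicator_def simp del: sum_mult_of_bool_eq)
  qed
qed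

section \<open>Limits of Campbell integrals\<close>

lemma measurable_mark:
  assumes "case_prod h \<in> borel_measurable (config_space \<Otimes>\<^sub>M borel)" "N \<in> point_configs"
  shows "h N \<in> borel_measurable borel"
  using measurable_compose[OF measurable_Pair1'[of N config_space] assms(1)] assms(2) by simp

lemma measurable_campbell_integrand:
  assumes \<Phi> [measurable]: "\<Phi> \<in> M \<rightarrow>\<^sub>M config_space"
    and h: "case_prod h \<in> borel_measurable (config_space \<Otimes>\<^sub>M borel)" and [measurable]: "G \<in> sets borel"
  shows "(\<lambda>\<omega>. \<integral>\<^sup>+x\<in>G. h (\<Phi> \<omega>) x \<partial>\<Phi> \<omega>) \<in> borel_measurable M"
proof (rule measurable_integral_config[OF \<Phi>])
  have [measurable]: "(\<lambda>p. h (\<Phi> (fst p)) (snd p)) \<in> borel_measurable (M \<Otimes>\<^sub>M borel)"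
    using measurable_compose[OF _ h, of "\<lambda>p. (\<Phi> (fst p), snd p)"] by simp
  show "(\<lambda>(\<omega>, x). h (\<Phi> \<omega>) x * indicator G x) \<in> borel_measurable (M \<Otimes>\<^sub>M borel)"
    unfolding case_prod_beta by measurable
qed

lemma campbell_mono:
  assumes "\<Phi> \<in> M \<rightarrow>\<^sub>M config_space" "\<And>N x. N \<in> point_configs \<Longrightarrow> x \<in> G \<Longrightarrow> h N x \<le> h' N x"
  shows "campbell M \<Phi> h G \<le> campbell M \<Phi> h' G"
  unfolding campbell_def using measurable_space[OF assms(1)] assms(2)
  by (intro nn_integral_mono) (auto simp: indicator_def)

lemma campbell_monotone_convergence:
  assumes \<Phi>: "\<Phi> \<in> M \<rightarrow>\<^sub>M config_space" and G [measurable]: "G \<in> sets borel"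
    and h: "\<And>m. case_prod (h m) \<in> borel_measurable (config_space \<Otimes>\<^sub>M borel)"
    and inc: "\<And>N x. N \<in> point_configs \<Longrightarrow> incseq (\<lambda>m. h m N x)"
  shows "campbell M \<Phi> (\<lambda>N x. SUP m. h m N x) G = (SUP m. campbell M \<Phi> (h m) G)"
proof -
  have conf: "\<Phi> \<omega> \<in> point_configs" if "\<omega> \<in> space M" for \<omega>
    using measurable_space[OF \<Phi> that] by simp
  have "campbell M \<Phi> (\<lambda>N x. SUP m. h m N x) G = (\<integral>\<^sup>+\<omega>. (SUP m. \<integral>\<^sup>+x\<in>G. h m (\<Phi> \<omega>) x \<partial>\<Phi> \<omega>) \<partial>M)"
    unfolding campbell_def
  proof (rule nn_integral_cong)
    fix \<omega> assume "\<omega> \<in> space M"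
    note N = conf[OF this]
    have [measurable]: "h m (\<Phi> \<omega>) \<in> borel_measurable borel" for m
      by (rule measurable_mark[OF h N])
    have "(\<integral>\<^sup>+x\<in>G. (SUP m. h m (\<Phi> \<omega>) x) \<partial>\<Phi> \<omega>) = (\<integral>\<^sup>+x. (SUP m. h m (\<Phi> \<omega>) x * indicator G x) \<partial>\<Phi> \<omega>)"
      by (simp add: SUP_mult_right_ennreal)
    also have "\<dots> = (SUP m. \<integral>\<^sup>+x\<in>G. h m (\<Phi> \<omega>) x \<partial>\<Phi> \<omega>)"
      using inc[OF N] N
      by (intro nn_integral_monotone_convergence_SUP) (auto simp: incseq_def le_fun_def indicator_def)
    finally show "(\<integral>\<^sup>+x\<in>G. (SUP m. h m (\<Phi> \<omega>) x) \<partial>\<Phi> \<omega>) = (SUP m. \<integral>\<^sup>+x\<in>G. h m (\<Phi> \<omega>) x \<partial>\<Phi> \<omega>)" .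
  qed
  \<comment> \<open>Only the values of \<open>\<Phi>\<close> on the sample space are configurations, so monotonicity in \<open>m\<close> holds
    everywhere only after the integrands are set to zero outside it.\<close>
  also have "\<dots> = (\<integral>\<^sup>+\<omega>. (SUP m. if \<omega> \<in> space M then \<integral>\<^sup>+x\<in>G. h m (\<Phi> \<omega>) x \<partial>\<Phi> \<omega> else 0) \<partial>M)"
    by (intro nn_integral_cong) simp
  also have "\<dots> = (SUP m. \<integral>\<^sup>+\<omega>. (if \<omega> \<in> space M then \<integral>\<^sup>+x\<in>G. h m (\<Phi> \<omega>) x \<partial>\<Phi> \<omega> else 0) \<partial>M)"
  proof (rule nn_integral_monotone_convergence_SUP)
    show "incseq (\<lambda>m \<omega>. if \<omega> \<in> space M then \<integral>\<^sup>+x\<in>G. h m (\<Phi> \<omega>) x \<partial>\<Phi> \<omega> else 0)"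
      using inc[OF conf] by (auto simp: incseq_def le_fun_def indicator_def intro!: nn_integral_mono)
    show "(\<lambda>\<omega>. if \<omega> \<in> space M then \<integral>\<^sup>+x\<in>G. h m (\<Phi> \<omega>) x \<partial>\<Phi> \<omega> else 0) \<in> borel_measurable M" for m
      using measurable_campbell_integrand[OF \<Phi> h G, of m] by (rule measurable_cong[THEN iffD1, rotated]) simp
  qed
  also have "\<dots> = (SUP m. campbell M \<Phi> (h m) G)"
    unfolding campbell_def by (intro SUP_cong refl nn_integral_cong) simp
  finally show ?thesis .
qed

definition ball_mark :: "(real \<Rightarrow> real) \<Rightarrow> real \<Rightarrow> 'a::euclidean_space measure \<Rightarrow> 'a \<Rightarrow> ennreal" where
  "ball_mark \<psi> r N x = ennreal (\<psi> (measure N (cball x r)))"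

lemma measurable_ball_mark:
  assumes "continuous_on UNIV \<psi>"
  shows "case_prod (ball_mark \<psi> r) \<in> borel_measurable (config_space \<Otimes>\<^sub>M (borel :: 'a::euclidean_space measure))"
proof -
  have [measurable]: "\<psi> \<in> borel_measurable borel"
    using assms by (rule borel_measurable_continuous_onI)
  have [measurable]: "(\<lambda>p. emeasure (fst p) (cball (snd p) r))
      \<in> borel_measurable (config_space \<Otimes>\<^sub>M (borel :: 'a measure))"
    using measurable_ball_count[of r] by (simp add: case_prod_beta)
  show ?thesis
    unfolding ball_mark_def measure_def case_prod_beta by measurable
qed

lemma measure_mono_bounded:
  assumes "N \<in> point_configs" "A \<subseteq> B" "A \<in> sets borel" "B \<in> sets borel" "bounded B"
  shows "measure N A \<le> measure N B"
proof -
  have "emeasure N B \<noteq> \<infinity>"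
    using count_finite[OF assms(1,4,5)] by simp
  then show ?thesis
    using assms by (intro measure_mono_fmeasurable) (auto simp: fmeasurable_def less_top)
qed

text \<open>
  Closed balls of radius r + 1/(n+1) shrink to the closed ball of radius r, so the marks converge
  pointwise. Dominated convergence is needed twice, for the sum over the points and for the
  expectation, with the marks of radius r + 1 as majorants.
\<close>

lemma campbell_ball_right_continuous:
  fixes \<Phi> :: "'w \<Rightarrow> 'a::euclidean_space measure"
  assumes \<Phi>: "\<Phi> \<in> M \<rightarrow>\<^sub>M config_space" and G [measurable]: "G \<in> sets borel"
    and cont: "continuous_on UNIV \<psi>" and mono: "\<And>u v. 0 \<le> u \<Longrightarrow> u \<le> v \<Longrightarrow> \<psi> u \<le> \<psi> v"
    and fin: "campbell M \<Phi> (ball_mark \<psi> (r + 1)) G < \<infinity>"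
  shows "(\<lambda>n. campbell M \<Phi> (ball_mark \<psi> (r + 1 / real (Suc n))) G) \<longlonglongrightarrow> campbell M \<Phi> (ball_mark \<psi> r) G"
proof -
  have conf: "\<Phi> \<omega> \<in> point_configs" if "\<omega> \<in> space M" for \<omega>
    using measurable_space[OF \<Phi> that] by simp
  note meas = measurable_ball_mark[OF cont]
  have bound: "ball_mark \<psi> (r + 1 / real (Suc n)) N x \<le> ball_mark \<psi> (r + 1) N x"
    if "N \<in> point_configs" for N n and x :: 'a
    unfolding ball_mark_def using that
    by (intro ennreal_leI mono measure_mono_bounded subset_cball) (auto simp: divide_le_eq)
  have lim: "(\<lambda>n. ball_mark \<psi> (r + 1 / real (Suc n)) N x) \<longlonglongrightarrow> ball_mark \<psi> r N x"
    if N: "N \<in> point_configs" for N and x :: 'a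
  proof -
    have inter: "(\<Inter>n. cball x (r + 1 / real (Suc n))) = cball x r"
    proof
      show "(\<Inter>n. cball x (r + 1 / real (Suc n))) \<subseteq> cball x r"
      proof
        fix y assume y: "y \<in> (\<Inter>n. cball x (r + 1 / real (Suc n)))"
        have "(\<lambda>n. r + 1 / real (Suc n)) \<longlonglongrightarrow> r + 0"
          by (intro tendsto_intros LIMSEQ_inverse_real_of_nat[unfolded inverse_eq_divide])
        then have "dist x y \<le> r + 0"
          by (rule LIMSEQ_le_const) (use y in auto)
        then show "y \<in> cball x r" by simp
      qed
    qed (intro INT_greatest subset_cball, simp)
    have "(\<lambda>n. measure N (cball x (r + 1 / real (Suc n)))) \<longlonglongrightarrow> measure N (\<Inter>n. cball x (r + 1 / real (Suc n)))"
    proof (rule Lim_measure_decseq)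
      show "decseq (\<lambda>n. cball x (r + 1 / real (Suc n)))"
        by (intro decseq_SucI subset_cball) (simp add: frac_le)
      show "emeasure N (cball x (r + 1 / real (Suc n))) \<noteq> \<infinity>" for n
        using count_finite[OF N, of "cball x (r + 1 / real (Suc n))"] by simp
    qed (use N in auto)
    then have "(\<lambda>n. \<psi> (measure N (cball x (r + 1 / real (Suc n))))) \<longlonglongrightarrow> \<psi> (measure N (cball x r))"
      unfolding inter using cont by (intro isCont_tendsto_compose[of _ \<psi>]) (simp add: continuous_on_eq_continuous_at)
    then show ?thesis
      unfolding ball_mark_def by (rule tendsto_ennrealI)
  qed
  define F where "F \<rho> \<omega> = (\<integral>\<^sup>+x\<in>G. ball_mark \<psi> \<rho> (\<Phi> \<omega>) x \<partial>\<Phi> \<omega>)" for \<rho> \<omega>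
  have F [measurable]: "F \<rho> \<in> borel_measurable M" for \<rho>
    unfolding F_def by (rule measurable_campbell_integrand[OF \<Phi> meas G])
  have finF: "(\<integral>\<^sup>+\<omega>. F (r + 1) \<omega> \<partial>M) < \<infinity>"
    using fin by (simp add: campbell_def F_def)
  then have "AE \<omega> in M. F (r + 1) \<omega> \<noteq> \<infinity>"
    by (intro nn_integral_PInf_AE) auto
  then have conv: "AE \<omega> in M. (\<lambda>n. F (r + 1 / real (Suc n)) \<omega>) \<longlonglongrightarrow> F r \<omega>"
  proof (rule AE_mp, intro AE_I2 impI)
    fix \<omega> assume \<omega>: "\<omega> \<in> space M" and finite: "F (r + 1) \<omega> \<noteq> \<infinity>"
    note N = conf[OF \<omega>]
    have [measurable]: "ball_mark \<psi> \<rho> (\<Phi> \<omega>) \<in> borel_measurable borel" for \<rho>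
      by (rule measurable_mark[OF meas N])
    show "(\<lambda>n. F (r + 1 / real (Suc n)) \<omega>) \<longlonglongrightarrow> F r \<omega>"
      unfolding F_def
    proof (rule nn_integral_dominated_convergence[where w = "\<lambda>x. ball_mark \<psi> (r + 1) (\<Phi> \<omega>) x * indicator G x"])
      show "AE x in \<Phi> \<omega>. ball_mark \<psi> (r + 1 / real (Suc j)) (\<Phi> \<omega>) x * indicator G x
          \<le> ball_mark \<psi> (r + 1) (\<Phi> \<omega>) x * indicator G x" for j
        by (intro AE_I2 mult_right_mono bound N) simp
      show "(\<integral>\<^sup>+x\<in>G. ball_mark \<psi> (r + 1) (\<Phi> \<omega>) x \<partial>\<Phi> \<omega>) < \<infinity>"
        using finite by (simp add: F_def less_top)
      show "AE x in \<Phi> \<omega>. (\<lambda>j. ball_mark \<psi> (r + 1 / real (Suc j)) (\<Phi> \<omega>) x * indicator G x)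
          \<longlonglongrightarrow> ball_mark \<psi> r (\<Phi> \<omega>) x * indicator G x"
      proof (rule AE_I2)
        fix x
        show "(\<lambda>j. ball_mark \<psi> (r + 1 / real (Suc j)) (\<Phi> \<omega>) x * indicator G x)
          \<longlonglongrightarrow> ball_mark \<psi> r (\<Phi> \<omega>) x * indicator G x"
          using lim[OF N, of x] by (cases "x \<in> G") auto
      qed
    qed (use N in simp_all)
  qed
  show ?thesis
    unfolding campbell_def F_def[symmetric]
  proof (rule nn_integral_dominated_convergence[OF F F F _ finF conv])
    show "AE \<omega> in M. F (r + 1 / real (Suc j)) \<omega> \<le> F (r + 1) \<omega>" for j
      unfolding F_def by (intro AE_I2 nn_integral_mono mult_right_mono bound conf) auto
  qed
qed

section \<open>Comparison of Campbell integrals\<close>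

lemma SUP_clip_slope:
  assumes "0 \<le> u"
  shows "(SUP m. ennreal (clip_slope (real (Suc m)) u)) = ennreal u"
proof (rule antisym)
  show "(SUP m. ennreal (clip_slope (real (Suc m)) u)) \<le> ennreal u"
    using assms by (intro SUP_least ennreal_leI clip_slope_le) auto
  obtain m where "u \<le> real m" using real_arch_simple by blast
  then show "ennreal u \<le> (SUP m. ennreal (clip_slope (real (Suc m)) u))"
    by (intro SUP_upper2[of m]) (auto simp: clip_slope_small)
qed

lemma incseq_clip_slope: "0 \<le> u \<Longrightarrow> incseq (\<lambda>m. ennreal (clip_slope (real (Suc m)) u))"
  by (intro incseq_SucI ennreal_leI clip_slope_mono_level) auto

lemma campbell_SUP_clip:
  fixes \<Phi> :: "'w \<Rightarrow> 'a::euclidean_space measure"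
  assumes \<Phi>: "\<Phi> \<in> M \<rightarrow>\<^sub>M config_space" and G: "G \<in> sets borel"
  shows "campbell M \<Phi> (ball_mark (\<lambda>u. u) r) G =
    (SUP m. campbell M \<Phi> (ball_mark (clip_slope (real (Suc m))) r) G)"
proof -
  have "campbell M \<Phi> (ball_mark (\<lambda>u. u) r) G =
      campbell M \<Phi> (\<lambda>N x. SUP m. ball_mark (clip_slope (real (Suc m))) r N x) G"
    unfolding ball_mark_def by (simp only: SUP_clip_slope[OF measure_nonneg])
  also have "\<dots> = (SUP m. campbell M \<Phi> (ball_mark (clip_slope (real (Suc m))) r) G)"
  proof (rule campbell_monotone_convergence[OF \<Phi> G])
    show "case_prod (ball_mark (clip_slope (real (Suc m))) r) \<in> borel_measurable (config_space \<Otimes>\<^sub>M borel)" for m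
      by (intro measurable_ball_mark continuous_clip_slope) simp
    show "incseq (\<lambda>m. ball_mark (clip_slope (real (Suc m))) r N x)" for N and x :: 'a
      unfolding ball_mark_def by (intro incseq_clip_slope) simp
  qed
  finally show ?thesis .
qed

text \<open>
  The clipped squares grow linearly, so finite mean counts suffice for this comparison.
\<close>

lemma clipped_square_sum_dcx_le:
  fixes \<Phi>\<^sub>1 :: "'v \<Rightarrow> 'a::euclidean_space measure" and \<Phi>\<^sub>2 :: "'w \<Rightarrow> 'a measure"
    and Q :: "nat \<Rightarrow> 'a set" and n :: nat and k :: real
  defines "S N \<equiv> (\<Sum>i<n. ennreal (clip_slope k (measure N (Q i))) * emeasure N (Q i))"
  assumes \<Phi>: "\<Phi>\<^sub>1 \<in> M\<^sub>1 \<rightarrow>\<^sub>M config_space" "\<Phi>\<^sub>2 \<in> M\<^sub>2 \<rightarrow>\<^sub>M config_space"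
    and le: "pp_dcx_le M\<^sub>1 \<Phi>\<^sub>1 M\<^sub>2 \<Phi>\<^sub>2"
    and mean: "\<And>R. R \<in> sets borel \<Longrightarrow> bounded R \<Longrightarrow> (\<integral>\<^sup>+\<omega>. emeasure (\<Phi>\<^sub>1 \<omega>) R \<partial>M\<^sub>1) < \<infinity>"
      "\<And>R. R \<in> sets borel \<Longrightarrow> bounded R \<Longrightarrow> (\<integral>\<^sup>+\<omega>. emeasure (\<Phi>\<^sub>2 \<omega>) R \<partial>M\<^sub>2) < \<infinity>"
    and Q: "\<And>i. Q i \<in> sets borel" "\<And>i. bounded (Q i)" and n: "0 < n" and k: "0 < k"
  shows "(\<integral>\<^sup>+\<omega>. S (\<Phi>\<^sub>1 \<omega>) \<partial>M\<^sub>1) \<le> (\<integral>\<^sup>+\<omega>. S (\<Phi>\<^sub>2 \<omega>) \<partial>M\<^sub>2)"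
proof -
  define f where "f v = (\<Sum>i<n. v i * clip_slope k (v i))" for v :: "nat \<Rightarrow> real"
  have f: "ennreal (f (\<lambda>i\<in>{..<n}. measure N (Q i))) = S N" if "N \<in> point_configs" for N
  proof -
    have "ennreal (f (\<lambda>i\<in>{..<n}. measure N (Q i))) = (\<Sum>i<n. ennreal (measure N (Q i) * clip_slope k (measure N (Q i))))"
      using k by (simp add: f_def sum_ennreal clip_slope_nonneg)
    also have "\<dots> = S N"
      unfolding S_def using k
      by (intro sum.cong) (auto simp: count_eq_measure[OF that Q] ennreal_mult clip_slope_nonneg mult.commute)
    finally show ?thesis .
  qed
  have eq: "(\<integral>\<^sup>+\<omega>. f (\<lambda>i\<in>{..<n}. measure (\<Phi> \<omega>) (Q i)) \<partial>M) = (\<integral>\<^sup>+\<omega>. S (\<Phi> \<omega>) \<partial>M)"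
    if "\<Phi> \<in> M \<rightarrow>\<^sub>M config_space" for M :: "'x measure" and \<Phi>
    using measurable_space[OF that] by (intro nn_integral_cong f) simp
  have fin: "(\<integral>\<^sup>+\<omega>. S (\<Phi> \<omega>) \<partial>M) < \<infinity>"
    if \<Phi>: "\<Phi> \<in> M \<rightarrow>\<^sub>M config_space"
      and mean: "\<And>R. R \<in> sets borel \<Longrightarrow> bounded R \<Longrightarrow> (\<integral>\<^sup>+\<omega>. emeasure (\<Phi> \<omega>) R \<partial>M) < \<infinity>"
    for M :: "'x measure" and \<Phi>
  proof -
    have [measurable]: "(\<lambda>\<omega>. emeasure (\<Phi> \<omega>) (Q i)) \<in> borel_measurable M" for i
      by (rule measurable_count_process[OF \<Phi> Q])
    have "(\<integral>\<^sup>+\<omega>. S (\<Phi> \<omega>) \<partial>M) \<le> (\<integral>\<^sup>+\<omega>. (\<Sum>i<n. ennreal (2 * k) * emeasure (\<Phi> \<omega>) (Q i)) \<partial>M)"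
      unfolding S_def using k
      by (intro nn_integral_mono sum_mono mult_right_mono ennreal_leI clip_slope_le_bound) auto
    also have "\<dots> = (\<Sum>i<n. ennreal (2 * k) * (\<integral>\<^sup>+\<omega>. emeasure (\<Phi> \<omega>) (Q i) \<partial>M))"
      by (simp add: nn_integral_sum nn_integral_cmult)
    also have "\<dots> < \<infinity>"
      using mean[OF Q] by (simp add: ennreal_mult_less_top)
    finally show ?thesis .
  qed
  have "(\<integral>\<^sup>+\<omega>. f (\<lambda>i\<in>{..<n}. measure (\<Phi>\<^sub>1 \<omega>) (Q i)) \<partial>M\<^sub>1) \<le> (\<integral>\<^sup>+\<omega>. f (\<lambda>i\<in>{..<n}. measure (\<Phi>\<^sub>2 \<omega>) (Q i)) \<partial>M\<^sub>2)"
  proof (rule dcx_expectation_le[OF \<Phi> le n Q])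
    show "dcx n f" unfolding f_def using k by (intro dcx_sum dcx_clip_square) auto
    have [measurable]: "clip_slope k \<in> borel_measurable borel"
      using continuous_clip_slope[OF k] by (rule borel_measurable_continuous_onI)
    have [measurable]: "(\<lambda>v. v i) \<in> borel_measurable (PiM {..<n} (\<lambda>_. borel :: real measure))" if "i < n" for i
      using that by (intro measurable_component_singleton) auto
    show "f \<in> borel_measurable (PiM {..<n} (\<lambda>_. borel))"
      unfolding f_def by (intro borel_measurable_sum borel_measurable_times) (auto intro: measurable_compose)
    show "0 \<le> f v" if "\<And>i. i < n \<Longrightarrow> 0 \<le> v i" for v
      unfolding f_def using that k by (intro sum_nonneg mult_nonneg_nonneg clip_slope_nonneg) auto
  qed (simp_all only: eq[OF \<Phi>(1)] eq[OF \<Phi>(2)] fin[OF \<Phi>(1) mean(1)] fin[OF \<Phi>(2) mean(2)])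
  then show ?thesis by (simp only: eq[OF \<Phi>(1)] eq[OF \<Phi>(2)])
qed

text \<open>
  The clipped square of N(Q_i) is N(Q_i) times a monotone function of N(Q_i). For x \<in> Q_i
  the piece contains x, which is the ball of radius 0, and lies in the ball of radius \<delta> around x,
  which squeezes the sum of clipped squares between two Campbell integrals.
\<close>

lemma campbell_clip_dcx_le:
  fixes \<Phi>\<^sub>1 :: "'v \<Rightarrow> 'a::euclidean_space measure" and \<Phi>\<^sub>2 :: "'w \<Rightarrow> 'a measure"
  assumes \<Phi>: "\<Phi>\<^sub>1 \<in> M\<^sub>1 \<rightarrow>\<^sub>M config_space" "\<Phi>\<^sub>2 \<in> M\<^sub>2 \<rightarrow>\<^sub>M config_space"
    and le: "pp_dcx_le M\<^sub>1 \<Phi>\<^sub>1 M\<^sub>2 \<Phi>\<^sub>2"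
    and mean: "\<And>R. R \<in> sets borel \<Longrightarrow> bounded R \<Longrightarrow> (\<integral>\<^sup>+\<omega>. emeasure (\<Phi>\<^sub>1 \<omega>) R \<partial>M\<^sub>1) < \<infinity>"
      "\<And>R. R \<in> sets borel \<Longrightarrow> bounded R \<Longrightarrow> (\<integral>\<^sup>+\<omega>. emeasure (\<Phi>\<^sub>2 \<omega>) R \<partial>M\<^sub>2) < \<infinity>"
    and G: "G \<in> sets borel" "bounded G" "G \<noteq> {}" and k: "0 < k" and \<delta>: "0 < \<delta>"
  shows "campbell M\<^sub>1 \<Phi>\<^sub>1 (ball_mark (clip_slope k) 0) G \<le> campbell M\<^sub>2 \<Phi>\<^sub>2 (ball_mark (clip_slope k) \<delta>) G"
proof -
  obtain n Q c where n: "0 < (n::nat)" and part: "disjoint_family_on Q {..<n}" "(\<Union>i<n. Q i) = G"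
    and Q: "\<And>i. Q i \<in> sets borel" "\<And>i. Q i \<subseteq> cball (c i) (\<delta> / 2)" "\<And>i. bounded (Q i)"
    by (rule bounded_borel_partition[OF G half_gt_zero[OF \<delta>]]) (rule that)
  define S where "S N = (\<Sum>i<n. ennreal (clip_slope k (measure N (Q i))) * emeasure N (Q i))" for N
  have lower: "(\<integral>\<^sup>+x\<in>G. ball_mark (clip_slope k) 0 N x \<partial>N) \<le> S N"
    and upper: "S N \<le> (\<integral>\<^sup>+x\<in>G. ball_mark (clip_slope k) \<delta> N x \<partial>N)" if N: "N \<in> point_configs" for N
  proof -
    have Qs: "\<And>i. Q i \<in> sets N" using N Q by simp
    show "(\<integral>\<^sup>+x\<in>G. ball_mark (clip_slope k) 0 N x \<partial>N) \<le> S N"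
      unfolding S_def ball_mark_def
      using k N Q(1,3)
      by (intro partition_sum_bounds[OF part(1) Qs part(2)] ennreal_leI clip_slope_mono measure_mono_bounded) auto
    have "Q i \<subseteq> cball x \<delta>" if "x \<in> Q i" for i x
    proof
      fix y assume "y \<in> Q i"
      then have "dist (c i) x \<le> \<delta> / 2" "dist (c i) y \<le> \<delta> / 2"
        using subsetD[OF Q(2)[of i], of x] subsetD[OF Q(2)[of i], of y] that by simp_all
      then show "y \<in> cball x \<delta>"
        using dist_triangle3[of x y "c i"] by simp
    qed
    then show "S N \<le> (\<integral>\<^sup>+x\<in>G. ball_mark (clip_slope k) \<delta> N x \<partial>N)"
      unfolding S_def ball_mark_def
      using k N Q(1)
      by (intro partition_sum_bounds[OF part(1) Qs part(2)] ennreal_leI clip_slope_mono measure_mono_bounded) auto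
  qed
  have "campbell M\<^sub>1 \<Phi>\<^sub>1 (ball_mark (clip_slope k) 0) G \<le> (\<integral>\<^sup>+\<omega>. S (\<Phi>\<^sub>1 \<omega>) \<partial>M\<^sub>1)"
    unfolding campbell_def using measurable_space[OF \<Phi>(1)] by (intro nn_integral_mono lower) simp
  also have "\<dots> \<le> (\<integral>\<^sup>+\<omega>. S (\<Phi>\<^sub>2 \<omega>) \<partial>M\<^sub>2)"
    unfolding S_def by (rule clipped_square_sum_dcx_le[OF \<Phi> le mean Q(1,3) n k])
  also have "\<dots> \<le> campbell M\<^sub>2 \<Phi>\<^sub>2 (ball_mark (clip_slope k) \<delta>) G"
    unfolding campbell_def using measurable_space[OF \<Phi>(2)] by (intro nn_integral_mono upper) simp
  finally show ?thesis .
qed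

text \<open>
  Squares of counts need not be integrable a priori, so the order is applied to the clipped squares,
  which increase to the square.
\<close>

lemma second_moment_dcx_le:
  fixes \<Phi>\<^sub>1 :: "'v \<Rightarrow> 'a::euclidean_space measure" and \<Phi>\<^sub>2 :: "'w \<Rightarrow> 'a measure"
  assumes \<Phi>: "\<Phi>\<^sub>1 \<in> M\<^sub>1 \<rightarrow>\<^sub>M config_space" "\<Phi>\<^sub>2 \<in> M\<^sub>2 \<rightarrow>\<^sub>M config_space"
    and le: "pp_dcx_le M\<^sub>1 \<Phi>\<^sub>1 M\<^sub>2 \<Phi>\<^sub>2"
    and mean: "\<And>R. R \<in> sets borel \<Longrightarrow> bounded R \<Longrightarrow> (\<integral>\<^sup>+\<omega>. emeasure (\<Phi>\<^sub>1 \<omega>) R \<partial>M\<^sub>1) < \<infinity>"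
      "\<And>R. R \<in> sets borel \<Longrightarrow> bounded R \<Longrightarrow> (\<integral>\<^sup>+\<omega>. emeasure (\<Phi>\<^sub>2 \<omega>) R \<partial>M\<^sub>2) < \<infinity>"
    and R: "R \<in> sets borel" "bounded R"
  shows "(\<integral>\<^sup>+\<omega>. (emeasure (\<Phi>\<^sub>1 \<omega>) R)\<^sup>2 \<partial>M\<^sub>1) \<le> (\<integral>\<^sup>+\<omega>. (emeasure (\<Phi>\<^sub>2 \<omega>) R)\<^sup>2 \<partial>M\<^sub>2)"
proof -
  define T where "T m N = ennreal (clip_slope (real (Suc m)) (measure N R)) * emeasure N R" for m N
  have SUP_T: "(SUP m. T m N) = (emeasure N R)\<^sup>2" if "N \<in> point_configs" for N
    unfolding T_def
    by (simp add: SUP_mult_right_ennreal[symmetric] SUP_clip_slope count_eq_measure[OF that R] power2_eq_square del: of_nat_Suc)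
  have T_upper: "T m N \<le> (emeasure N R)\<^sup>2" if "N \<in> point_configs" for m N
    unfolding SUP_T[OF that, symmetric] by (rule SUP_upper) simp
  have T_le: "(\<integral>\<^sup>+\<omega>. T m (\<Phi>\<^sub>1 \<omega>) \<partial>M\<^sub>1) \<le> (\<integral>\<^sup>+\<omega>. (emeasure (\<Phi>\<^sub>2 \<omega>) R)\<^sup>2 \<partial>M\<^sub>2)" for m
  proof -
    have "(\<integral>\<^sup>+\<omega>. T m (\<Phi>\<^sub>1 \<omega>) \<partial>M\<^sub>1) \<le> (\<integral>\<^sup>+\<omega>. T m (\<Phi>\<^sub>2 \<omega>) \<partial>M\<^sub>2)"
    proof -
      have T_sum: "T m N = (\<Sum>i<1::nat. ennreal (clip_slope (real (Suc m)) (measure N R)) * emeasure N R)" for N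
        by (simp add: T_def lessThan_Suc del: of_nat_Suc sum_constant)
      have k: "0 < real (Suc m)" by simp
      show ?thesis
        unfolding T_sum by (rule clipped_square_sum_dcx_le[OF \<Phi> le mean R zero_less_one k])
    qed
    also have "\<dots> \<le> (\<integral>\<^sup>+\<omega>. (emeasure (\<Phi>\<^sub>2 \<omega>) R)\<^sup>2 \<partial>M\<^sub>2)"
      using measurable_space[OF \<Phi>(2)]
      by (intro nn_integral_mono T_upper) simp
    finally show ?thesis .
  qed
  have T_meas: "(\<lambda>\<omega>. T m (\<Phi>\<^sub>1 \<omega>)) \<in> borel_measurable M\<^sub>1" for m
  proof -
    have [measurable]: "clip_slope (real (Suc m)) \<in> borel_measurable borel"
      by (intro borel_measurable_continuous_onI continuous_clip_slope) simp
    note [measurable] = measurable_count_process[OF \<Phi>(1) R]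
    show ?thesis unfolding T_def by measurable
  qed
  have "(\<integral>\<^sup>+\<omega>. (emeasure (\<Phi>\<^sub>1 \<omega>) R)\<^sup>2 \<partial>M\<^sub>1) = (\<integral>\<^sup>+\<omega>. (SUP m. T m (\<Phi>\<^sub>1 \<omega>)) \<partial>M\<^sub>1)"
    using measurable_space[OF \<Phi>(1)] by (intro nn_integral_cong) (simp add: SUP_T)
  also have "\<dots> = (SUP m. \<integral>\<^sup>+\<omega>. T m (\<Phi>\<^sub>1 \<omega>) \<partial>M\<^sub>1)"
  proof (rule nn_integral_monotone_convergence_SUP)
    show "incseq (\<lambda>m \<omega>. T m (\<Phi>\<^sub>1 \<omega>))"
      unfolding T_def incseq_def le_fun_def
      using incseqD[OF incseq_clip_slope[OF measure_nonneg]] by (intro allI impI mult_right_mono) simp_all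
  qed (rule T_meas)
  also have "\<dots> \<le> (\<integral>\<^sup>+\<omega>. (emeasure (\<Phi>\<^sub>2 \<omega>) R)\<^sup>2 \<partial>M\<^sub>2)"
    by (intro SUP_least T_le)
  finally show ?thesis .
qed

text \<open>
  For x \<in> Q_i the ball of radius r + \<delta>/2 around the centre c_i lies between the balls of
  radius r and r + \<delta> around x. The coordinates 0, ..., n - 1 of the vector carry the
  counts of the pieces, the coordinates n, ..., 2n - 1 those of the balls.
\<close>

lemma campbell_ball_dcx_le:
  fixes \<Phi>\<^sub>1 :: "'v \<Rightarrow> 'a::euclidean_space measure" and \<Phi>\<^sub>2 :: "'w \<Rightarrow> 'a measure"
  assumes \<Phi>: "\<Phi>\<^sub>1 \<in> M\<^sub>1 \<rightarrow>\<^sub>M config_space" "\<Phi>\<^sub>2 \<in> M\<^sub>2 \<rightarrow>\<^sub>M config_space"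
    and le: "pp_dcx_le M\<^sub>1 \<Phi>\<^sub>1 M\<^sub>2 \<Phi>\<^sub>2"
    and second: "\<And>R. R \<in> sets borel \<Longrightarrow> bounded R \<Longrightarrow> (\<integral>\<^sup>+\<omega>. (emeasure (\<Phi>\<^sub>1 \<omega>) R)\<^sup>2 \<partial>M\<^sub>1) < \<infinity>"
      "\<And>R. R \<in> sets borel \<Longrightarrow> bounded R \<Longrightarrow> (\<integral>\<^sup>+\<omega>. (emeasure (\<Phi>\<^sub>2 \<omega>) R)\<^sup>2 \<partial>M\<^sub>2) < \<infinity>"
    and G: "G \<in> sets borel" "bounded G" "G \<noteq> {}" and \<delta>: "0 < \<delta>"
  shows "campbell M\<^sub>1 \<Phi>\<^sub>1 (ball_mark (\<lambda>u. u) r) G \<le> campbell M\<^sub>2 \<Phi>\<^sub>2 (ball_mark (\<lambda>u. u) (r + \<delta>)) G"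
proof -
  obtain n Q c where n: "0 < (n::nat)" and part: "disjoint_family_on Q {..<n}" "(\<Union>i<n. Q i) = G"
    and Q: "\<And>i. Q i \<in> sets borel" "\<And>i. Q i \<subseteq> cball (c i) (\<delta> / 2)" "\<And>i. bounded (Q i)"
    by (rule bounded_borel_partition[OF G half_gt_zero[OF \<delta>]]) (rule that)
  define D where "D i = cball (c i) (r + \<delta> / 2)" for i
  define A where "A i = (if i < n then Q i else D (i - n))" for i
  define f where "f v = (\<Sum>i<n. v (n + i) * v i)" for v :: "nat \<Rightarrow> real"
  define S where "S N = (\<Sum>i<n. emeasure N (D i) * emeasure N (Q i))" for N
  have A: "A i \<in> sets borel" "bounded (A i)" for i
    using Q by (auto simp: A_def D_def)
  have lower: "(\<integral>\<^sup>+x\<in>G. ball_mark (\<lambda>u. u) r N x \<partial>N) \<le> S N"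
    and upper: "S N \<le> (\<integral>\<^sup>+x\<in>G. ball_mark (\<lambda>u. u) (r + \<delta>) N x \<partial>N)" if N: "N \<in> point_configs" for N
  proof -
    have Qs: "\<And>i. Q i \<in> sets N" using N Q by simp
    have ball: "ball_mark (\<lambda>u. u) \<rho> N x = emeasure N (cball x \<rho>)" for \<rho> x
      using count_eq_measure[OF N, of "cball x \<rho>"] by (simp add: ball_mark_def)
    have sub: "cball x r \<subseteq> D i" "D i \<subseteq> cball x (r + \<delta>)" if "x \<in> Q i" for i x
    proof -
      have d: "dist (c i) x \<le> \<delta> / 2" using subsetD[OF Q(2) that] by simp
      show "cball x r \<subseteq> D i"
        unfolding D_def cball_subset_cball_iff using d by (auto simp: dist_commute)
      show "D i \<subseteq> cball x (r + \<delta>)"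
        unfolding D_def cball_subset_cball_iff using d by (auto simp: dist_commute)
    qed
    show "(\<integral>\<^sup>+x\<in>G. ball_mark (\<lambda>u. u) r N x \<partial>N) \<le> S N"
      unfolding S_def ball using sub(1) N
      by (intro partition_sum_bounds[OF part(1) Qs part(2)] emeasure_mono) (auto simp: D_def)
    show "S N \<le> (\<integral>\<^sup>+x\<in>G. ball_mark (\<lambda>u. u) (r + \<delta>) N x \<partial>N)"
      unfolding S_def ball using sub(2) N
      by (intro partition_sum_bounds[OF part(1) Qs part(2)] emeasure_mono) (auto simp: D_def)
  qed
  have f: "ennreal (f (\<lambda>i\<in>{..<2 * n}. measure N (A i))) = S N" if "N \<in> point_configs" for N
  proof -
    have "f (\<lambda>i\<in>{..<2 * n}. measure N (A i)) = (\<Sum>i<n. measure N (D i) * measure N (Q i))"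
      unfolding f_def by (intro sum.cong) (auto simp: A_def)
    then show ?thesis
      using count_eq_measure[OF that Q(1,3)] count_eq_measure[OF that, of "D i" for i]
      by (simp add: S_def sum_ennreal[symmetric] ennreal_mult D_def)
  qed
  have eq: "(\<integral>\<^sup>+\<omega>. f (\<lambda>i\<in>{..<2 * n}. measure (\<Phi> \<omega>) (A i)) \<partial>M) = (\<integral>\<^sup>+\<omega>. S (\<Phi> \<omega>) \<partial>M)"
    if "\<Phi> \<in> M \<rightarrow>\<^sub>M config_space" for M :: "'x measure" and \<Phi>
    using measurable_space[OF that] by (intro nn_integral_cong f) simp
  \<comment> \<open>One bounded set whose squared count dominates every product in the sum.\<close>
  define R where "R = (\<Union>i<n. Q i \<union> D i)"
  have R: "R \<in> sets borel" "bounded R"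
    using Q by (auto simp: R_def D_def)
  have fin: "(\<integral>\<^sup>+\<omega>. S (\<Phi> \<omega>) \<partial>M) < \<infinity>"
    if \<Phi>: "\<Phi> \<in> M \<rightarrow>\<^sub>M config_space" and second: "(\<integral>\<^sup>+\<omega>. (emeasure (\<Phi> \<omega>) R)\<^sup>2 \<partial>M) < \<infinity>"
    for M :: "'x measure" and \<Phi>
  proof -
    note [measurable] = measurable_count_process(1)[OF \<Phi> R]
    have "(\<integral>\<^sup>+\<omega>. S (\<Phi> \<omega>) \<partial>M) \<le> (\<integral>\<^sup>+\<omega>. of_nat n * (emeasure (\<Phi> \<omega>) R)\<^sup>2 \<partial>M)"
    proof (rule nn_integral_mono)
      fix \<omega> assume "\<omega> \<in> space M"
      then have "\<Phi> \<omega> \<in> point_configs" using measurable_space[OF \<Phi>] by simp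
      then have "emeasure (\<Phi> \<omega>) (D i) * emeasure (\<Phi> \<omega>) (Q i) \<le> emeasure (\<Phi> \<omega>) R * emeasure (\<Phi> \<omega>) R"
        if "i < n" for i
        using that R by (intro mult_mono emeasure_mono) (auto simp: R_def)
      then have "S (\<Phi> \<omega>) \<le> (\<Sum>i<n. (emeasure (\<Phi> \<omega>) R)\<^sup>2)"
        unfolding S_def power2_eq_square by (intro sum_mono) auto
      then show "S (\<Phi> \<omega>) \<le> of_nat n * (emeasure (\<Phi> \<omega>) R)\<^sup>2" by simp
    qed
    also have "\<dots> = of_nat n * (\<integral>\<^sup>+\<omega>. (emeasure (\<Phi> \<omega>) R)\<^sup>2 \<partial>M)"
      by (simp add: nn_integral_cmult)
    also have "\<dots> < \<infinity>"
      using second by (simp add: ennreal_mult_less_top of_nat_less_top)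
    finally show ?thesis .
  qed
  have "(\<integral>\<^sup>+\<omega>. f (\<lambda>i\<in>{..<2 * n}. measure (\<Phi>\<^sub>1 \<omega>) (A i)) \<partial>M\<^sub>1)
      \<le> (\<integral>\<^sup>+\<omega>. f (\<lambda>i\<in>{..<2 * n}. measure (\<Phi>\<^sub>2 \<omega>) (A i)) \<partial>M\<^sub>2)"
  proof (rule dcx_expectation_le[OF \<Phi> le _ A])
    show "dcx (2 * n) f" unfolding f_def by (intro dcx_sum dcx_mult) auto
    show "f \<in> borel_measurable (PiM {..<2 * n} (\<lambda>_. borel))"
      unfolding f_def
      by (intro borel_measurable_sum borel_measurable_times measurable_component_singleton) auto
    show "0 \<le> f v" if "\<And>i. i < 2 * n \<Longrightarrow> 0 \<le> v i" for v
      unfolding f_def using that by (intro sum_nonneg mult_nonneg_nonneg) auto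
    show "0 < 2 * n" using n by simp
  qed (simp_all only: eq[OF \<Phi>(1)] eq[OF \<Phi>(2)] fin[OF \<Phi>(1) second(1)[OF R]] fin[OF \<Phi>(2) second(2)[OF R]])
  then have middle: "(\<integral>\<^sup>+\<omega>. S (\<Phi>\<^sub>1 \<omega>) \<partial>M\<^sub>1) \<le> (\<integral>\<^sup>+\<omega>. S (\<Phi>\<^sub>2 \<omega>) \<partial>M\<^sub>2)"
    by (simp only: eq[OF \<Phi>(1)] eq[OF \<Phi>(2)])
  have "campbell M\<^sub>1 \<Phi>\<^sub>1 (ball_mark (\<lambda>u. u) r) G \<le> (\<integral>\<^sup>+\<omega>. S (\<Phi>\<^sub>1 \<omega>) \<partial>M\<^sub>1)"
    unfolding campbell_def using measurable_space[OF \<Phi>(1)] by (intro nn_integral_mono lower) simp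
  also note middle
  also have "(\<integral>\<^sup>+\<omega>. S (\<Phi>\<^sub>2 \<omega>) \<partial>M\<^sub>2) \<le> campbell M\<^sub>2 \<Phi>\<^sub>2 (ball_mark (\<lambda>u. u) (r + \<delta>)) G"
    unfolding campbell_def using measurable_space[OF \<Phi>(2)] by (intro nn_integral_mono upper) simp
  finally show ?thesis .
qed

section \<open>Ripley's function\<close>

lemma emeasure_shift_cball:
  assumes "N \<in> point_configs"
  shows "emeasure (shift t N) (cball (x + t) r) = emeasure N (cball x r)"
proof -
  have "(\<lambda>y. y + t) -` cball (x + t) r = cball x r"
    by auto
  then show ?thesis
    using assms by (simp add: emeasure_distr)
qed

lemma campbell_one:
  assumes "\<Phi> \<in> M \<rightarrow>\<^sub>M config_space" "G \<in> sets borel"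
  shows "campbell M \<Phi> (\<lambda>_ _. 1) G = intensity M \<Phi> G"
  unfolding campbell_def intensity_def using measurable_space[OF assms(1)] assms(2)
  by (intro nn_integral_cong) simp

lemma intensity_proportional_lborel:
  assumes "point_process M \<Phi>" "stationary M \<Phi>" "B \<in> sets borel" "emeasure lborel B = 1" "G \<in> sets borel"
  shows "intensity M \<Phi> G = intensity M \<Phi> B * emeasure lborel G"
  using campbell_proportional_lborel[OF assms(1,2), of "\<lambda>_ _. 1" G B] assms
  by (simp add: campbell_one point_process_def)

lemma intensity_finite:
  assumes "point_process M \<Phi>" "stationary M \<Phi>" "B \<in> sets borel" "emeasure lborel B = 1"
    and "intensity M \<Phi> B < \<infinity>" and R: "R \<in> sets borel" "bounded R"
  shows "(\<integral>\<^sup>+\<omega>. emeasure (\<Phi> \<omega>) R \<partial>M) < \<infinity>"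
proof -
  have "emeasure lborel R < \<infinity>" using R(2) by (rule emeasure_bounded_finite)
  then show ?thesis
    using intensity_proportional_lborel[OF assms(1-4) R(1)] assms(5)
    by (simp add: intensity_def ennreal_mult_less_top)
qed

lemma ball_mark_id:
  assumes "N \<in> point_configs"
  shows "ball_mark (\<lambda>u. u) r N x = emeasure N (cball x r)"
  using count_eq_measure[OF assms, of "cball x r"] by (simp add: ball_mark_def)

text \<open>
  This makes the subtraction of the point itself in Ripley's function exact in the extended
  nonnegative reals, where a negative difference would be cut off at zero.
\<close>

lemma own_point_in_ball:
  assumes N: "N \<in> point_configs" and r: "0 \<le> r"
  shows "AE x in N. 1 \<le> emeasure N (cball x r)"
proof -
  have [measurable]: "(\<lambda>x. emeasure N (cball x r)) \<in> borel_measurable borel"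
    using measurable_mark[OF _ N, of "\<lambda>N x. emeasure N (cball x r)"] measurable_ball_count by simp
  obtain I X where NX: "N = distr (count_space I) borel (X :: nat \<Rightarrow> 'a)"
    using N unfolding point_configs_def by blast
  have "1 \<le> emeasure N (cball (X i) r)" if i: "i \<in> I" for i
  proof -
    have "1 = emeasure (count_space I) {i}" using i by simp
    also have "\<dots> \<le> emeasure (count_space I) (X -` cball (X i) r \<inter> I)"
      using i r by (intro emeasure_mono) auto
    also have "\<dots> = emeasure N (cball (X i) r)"
      unfolding NX by (simp add: emeasure_distr)
    finally show ?thesis .
  qed
  then have "AE i in count_space I. 1 \<le> emeasure N (cball (X i) r)"
    by (simp add: AE_count_space)
  moreover have "{x \<in> space borel. 1 \<le> emeasure N (cball x r)} \<in> sets borel"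
    by measurable
  ultimately have "AE x in distr (count_space I) borel X. 1 \<le> emeasure N (cball x r)"
    by (subst AE_distr_iff) simp_all
  then show ?thesis unfolding NX[symmetric] .
qed

lemma campbell_ball_decompose:
  fixes \<Phi> :: "'w \<Rightarrow> 'a::euclidean_space measure"
  assumes \<Phi>: "\<Phi> \<in> M \<rightarrow>\<^sub>M config_space" and G [measurable]: "G \<in> sets borel" and r: "0 \<le> r"
  shows "campbell M \<Phi> (ball_mark (\<lambda>u. u) r) G =
    intensity M \<Phi> G + campbell M \<Phi> (\<lambda>N x. emeasure N (cball x r) - 1) G"
proof -
  have [measurable]: "(\<lambda>(N, x). emeasure N (cball x r) - 1) \<in> borel_measurable (config_space \<Otimes>\<^sub>M (borel :: 'a measure))"
    using measurable_ball_count[of r] unfolding case_prod_beta by measurable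
  have "(\<integral>\<^sup>+x\<in>G. ball_mark (\<lambda>u. u) r (\<Phi> \<omega>) x \<partial>\<Phi> \<omega>) =
      emeasure (\<Phi> \<omega>) G + (\<integral>\<^sup>+x\<in>G. (emeasure (\<Phi> \<omega>) (cball x r) - 1) \<partial>\<Phi> \<omega>)"
    if "\<omega> \<in> space M" for \<omega>
  proof -
    have N: "\<Phi> \<omega> \<in> point_configs" using measurable_space[OF \<Phi> that] by simp
    have [measurable]: "(\<lambda>x. emeasure (\<Phi> \<omega>) (cball x r)) \<in> borel_measurable borel"
      using measurable_mark[OF _ N, of "\<lambda>N x. emeasure N (cball x r)"] measurable_ball_count by simp
    have "(\<integral>\<^sup>+x\<in>G. ball_mark (\<lambda>u. u) r (\<Phi> \<omega>) x \<partial>\<Phi> \<omega>) =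
        (\<integral>\<^sup>+x. indicator G x + (emeasure (\<Phi> \<omega>) (cball x r) - 1) * indicator G x \<partial>\<Phi> \<omega>)"
      using own_point_in_ball[OF N r]
    proof (intro nn_integral_cong_AE, elim AE_mp, intro AE_I2 impI)
      fix x assume "1 \<le> emeasure (\<Phi> \<omega>) (cball x r)"
      then have "emeasure (\<Phi> \<omega>) (cball x r) = 1 + (emeasure (\<Phi> \<omega>) (cball x r) - 1)"
        by (rule ennreal_ineq_diff_add)
      then show "ball_mark (\<lambda>u. u) r (\<Phi> \<omega>) x * indicator G x =
          indicator G x + (emeasure (\<Phi> \<omega>) (cball x r) - 1) * indicator G x"
        by (simp add: ball_mark_id[OF N] indicator_def)
    qed
    also have "\<dots> = emeasure (\<Phi> \<omega>) G + (\<integral>\<^sup>+x\<in>G. (emeasure (\<Phi> \<omega>) (cball x r) - 1) \<partial>\<Phi> \<omega>)"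
      using N by (subst nn_integral_add) simp_all
    finally show ?thesis .
  qed
  then have "campbell M \<Phi> (ball_mark (\<lambda>u. u) r) G =
      (\<integral>\<^sup>+\<omega>. emeasure (\<Phi> \<omega>) G + (\<integral>\<^sup>+x\<in>G. (emeasure (\<Phi> \<omega>) (cball x r) - 1) \<partial>\<Phi> \<omega>) \<partial>M)"
    unfolding campbell_def by (intro nn_integral_cong)
  also have "\<dots> = intensity M \<Phi> G + campbell M \<Phi> (\<lambda>N x. emeasure N (cball x r) - 1) G"
    unfolding intensity_def campbell_def
  proof (rule nn_integral_add)
    show "(\<lambda>\<omega>. \<integral>\<^sup>+x\<in>G. (emeasure (\<Phi> \<omega>) (cball x r) - 1) \<partial>\<Phi> \<omega>) \<in> borel_measurable M"
      by (rule measurable_campbell_integrand[OF \<Phi>]) measurable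
    show "(\<lambda>\<omega>. emeasure (\<Phi> \<omega>) G) \<in> borel_measurable M"
      using measurable_campbell_integrand[OF \<Phi>, of "\<lambda>_ _. 1" G] measurable_space[OF \<Phi>]
      by (subst measurable_cong) simp_all
  qed
  finally show ?thesis .
qed

text \<open>
  All windows are reduced to one reference set of unit volume, which may be chosen common to several
  processes.
\<close>

lemma ripley_K_eq:
  fixes \<Phi> :: "'w \<Rightarrow> 'a::euclidean_space measure"
  assumes pp: "point_process M \<Phi>" and st: "stationary M \<Phi>"
    and B: "B \<in> sets borel" "emeasure lborel B = 1"
    and C: "C \<in> sets borel" "emeasure lborel C = 1"
    and G: "G \<in> sets borel" "bounded G" "0 < emeasure lborel G"
  shows "ripley_K M \<Phi> B G r = campbell M \<Phi> (\<lambda>N x. emeasure N (cball x r) - 1) C / intensity M \<Phi> C"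
proof -
  have meas: "(\<lambda>(N, x). emeasure N (cball x r) - 1) \<in> borel_measurable (config_space \<Otimes>\<^sub>M (borel :: 'a measure))"
    using measurable_ball_count[of r] unfolding case_prod_beta by measurable
  have "campbell M \<Phi> (\<lambda>N x. emeasure N (cball x r) - 1) G =
      campbell M \<Phi> (\<lambda>N x. emeasure N (cball x r) - 1) C * emeasure lborel G"
    using campbell_proportional_lborel[OF pp st meas _ G(1) C(1)] C(2) by (simp add: emeasure_shift_cball)
  moreover have "intensity M \<Phi> C = intensity M \<Phi> B"
    using intensity_proportional_lborel[OF pp st B C(1)] C(2) by simp
  moreover have "emeasure lborel G \<noteq> \<infinity>" "emeasure lborel G \<noteq> 0"
    using emeasure_bounded_finite[OF G(2)] G(3) by auto
  moreover have "ripley_K M \<Phi> B G r =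
      campbell M \<Phi> (\<lambda>N x. emeasure N (cball x r) - 1) G / (intensity M \<Phi> B * emeasure lborel G)"
    by (simp add: ripley_K_def campbell_def)
  ultimately show ?thesis
    by (simp add: divide_mult_eq)
qed

text \<open>
  Cut R into n pieces of diameter at most r. Each piece lies in the ball of radius r around
  any of its points, so the Campbell integral dominates the sum of the squared counts of the pieces,
  and by the Cauchy-Schwarz inequality n times that sum dominates the squared count of R.
\<close>

lemma second_moment_finite:
  fixes \<Phi> :: "'w \<Rightarrow> 'a::euclidean_space measure"
  assumes \<Phi>: "\<Phi> \<in> M \<rightarrow>\<^sub>M config_space" and R: "R \<in> sets borel" "bounded R" and r: "0 < r"
    and fin: "campbell M \<Phi> (ball_mark (\<lambda>u. u) r) R < \<infinity>"
  shows "(\<integral>\<^sup>+\<omega>. (emeasure (\<Phi> \<omega>) R)\<^sup>2 \<partial>M) < \<infinity>"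
proof (cases "R = {}")
  case False
  obtain n Q c where part: "disjoint_family_on Q {..<n::nat}" "(\<Union>i<n. Q i) = R"
    and Q: "\<And>i. Q i \<in> sets borel" "\<And>i. Q i \<subseteq> cball (c i) (r / 2)" "\<And>i. bounded (Q i)"
    by (rule bounded_borel_partition[OF R False half_gt_zero[OF r]]) (rule that)
  have bound: "(emeasure N R)\<^sup>2 \<le> of_nat n * (\<integral>\<^sup>+x\<in>R. ball_mark (\<lambda>u. u) r N x \<partial>N)"
    if N: "N \<in> point_configs" for N
  proof -
    have Qs: "\<And>i. Q i \<in> sets N" using N Q by simp
    have "emeasure N R = (\<Sum>i<n. emeasure N (Q i))"
      unfolding part(2)[symmetric] by (rule sum_emeasure[symmetric]) (use part(1) Qs in auto)
    also have "\<dots> = ennreal (\<Sum>i<n. measure N (Q i))"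
      by (simp add: count_eq_measure[OF N Q(1,3)])
    finally have "(emeasure N R)\<^sup>2 = ennreal ((\<Sum>i<n. measure N (Q i))\<^sup>2)"
      by (simp add: ennreal_power sum_nonneg)
    also have "\<dots> \<le> ennreal (real n * (\<Sum>i<n. (measure N (Q i))\<^sup>2))"
      using sum_squared_le_sum_of_squares[of "\<lambda>i. measure N (Q i)" "{..<n}"]
      by (intro ennreal_leI) (simp add: mult.commute)
    also have "\<dots> = of_nat n * (\<Sum>i<n. emeasure N (Q i) * emeasure N (Q i))"
    proof -
      have "ennreal (\<Sum>i<n. (measure N (Q i))\<^sup>2) = (\<Sum>i<n. ennreal ((measure N (Q i))\<^sup>2))"
        by (rule sum_ennreal[symmetric]) simp
      also have "\<dots> = (\<Sum>i<n. emeasure N (Q i) * emeasure N (Q i))"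
        by (simp add: count_eq_measure[OF N Q(1,3)] power2_eq_square ennreal_mult)
      finally show ?thesis
        by (simp add: ennreal_mult sum_nonneg ennreal_of_nat_eq_real_of_nat)
    qed
    also have "\<dots> \<le> of_nat n * (\<integral>\<^sup>+x\<in>R. ball_mark (\<lambda>u. u) r N x \<partial>N)"
    proof (rule mult_left_mono)
      show "(\<Sum>i<n. emeasure N (Q i) * emeasure N (Q i)) \<le> (\<integral>\<^sup>+x\<in>R. ball_mark (\<lambda>u. u) r N x \<partial>N)"
      proof (rule partition_sum_bounds(2)[OF part(1) Qs part(2)])
        fix i x assume x: "x \<in> Q i"
        have "Q i \<subseteq> cball x r"
        proof
          fix y assume "y \<in> Q i"
          then have "dist (c i) x \<le> r / 2" "dist (c i) y \<le> r / 2"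
            using subsetD[OF Q(2)[of i], of x] subsetD[OF Q(2)[of i], of y] x by simp_all
          then show "y \<in> cball x r"
            using dist_triangle3[of x y "c i"] by simp
        qed
        then show "emeasure N (Q i) \<le> ball_mark (\<lambda>u. u) r N x"
          unfolding ball_mark_id[OF N] using N by (intro emeasure_mono) auto
      qed
    qed simp
    finally show ?thesis .
  qed
  have "(\<integral>\<^sup>+\<omega>. (emeasure (\<Phi> \<omega>) R)\<^sup>2 \<partial>M) \<le> (\<integral>\<^sup>+\<omega>. of_nat n * (\<integral>\<^sup>+x\<in>R. ball_mark (\<lambda>u. u) r (\<Phi> \<omega>) x \<partial>\<Phi> \<omega>) \<partial>M)"
    using measurable_space[OF \<Phi>] by (intro nn_integral_mono bound) simp
  also have "\<dots> = of_nat n * campbell M \<Phi> (ball_mark (\<lambda>u. u) r) R"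
    unfolding campbell_def
    by (intro nn_integral_cmult measurable_campbell_integrand[OF \<Phi> measurable_ball_mark R(1)]) simp
  also have "\<dots> < \<infinity>"
    using fin by (simp add: ennreal_mult_less_top of_nat_less_top)
  finally show ?thesis .
qed simp

text \<open>
  The number of pairs of points with the first one in G and the second one at distance at most r
  is at most the squared count of a ball that contains G and all the balls around its points.
\<close>

lemma campbell_ball_finite:
  fixes \<Phi> :: "'w \<Rightarrow> 'a::euclidean_space measure"
  assumes \<Phi>: "\<Phi> \<in> M \<rightarrow>\<^sub>M config_space" and G: "G \<in> sets borel" "bounded G"
    and second: "\<And>R. R \<in> sets borel \<Longrightarrow> bounded R \<Longrightarrow> (\<integral>\<^sup>+\<omega>. (emeasure (\<Phi> \<omega>) R)\<^sup>2 \<partial>M) < \<infinity>"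
  shows "campbell M \<Phi> (ball_mark (\<lambda>u. u) r) G < \<infinity>"
proof -
  obtain b where b: "G \<subseteq> cball 0 b"
    using G(2) by (fastforce simp: bounded_iff)
  define R where "R = cball (0 :: 'a) (b + \<bar>r\<bar>)"
  have GR: "G \<subseteq> R" using b by (auto simp: R_def subset_iff)
  have ballR: "cball x r \<subseteq> R" if "x \<in> G" for x
    using b that unfolding R_def cball_subset_cball_iff by (auto simp: subset_iff)
  have "(\<integral>\<^sup>+x\<in>G. ball_mark (\<lambda>u. u) r N x \<partial>N) \<le> (emeasure N R)\<^sup>2" if N: "N \<in> point_configs" for N
  proof -
    have "(\<integral>\<^sup>+x\<in>G. ball_mark (\<lambda>u. u) r N x \<partial>N) \<le> (\<integral>\<^sup>+x. emeasure N R * indicator G x \<partial>N)"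
    proof (rule nn_integral_mono)
      fix x
      show "ball_mark (\<lambda>u. u) r N x * indicator G x \<le> emeasure N R * indicator G x"
        using ballR[of x] N by (auto simp: ball_mark_id[OF N] indicator_def R_def intro!: emeasure_mono)
    qed
    also have "\<dots> = emeasure N R * emeasure N G"
      using N G by (simp add: nn_integral_cmult_indicator)
    also have "\<dots> \<le> emeasure N R * emeasure N R"
      using GR N by (intro mult_left_mono emeasure_mono) (auto simp: R_def)
    finally show ?thesis by (simp add: power2_eq_square)
  qed
  then have "campbell M \<Phi> (ball_mark (\<lambda>u. u) r) G \<le> (\<integral>\<^sup>+\<omega>. (emeasure (\<Phi> \<omega>) R)\<^sup>2 \<partial>M)"
    unfolding campbell_def using measurable_space[OF \<Phi>] by (intro nn_integral_mono) simp
  also have "\<dots> < \<infinity>" by (rule second) (auto simp: R_def)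
  finally show ?thesis .
qed

text \<open>
  For r > 0 finiteness for the larger process yields second moments of both; for r = 0 it does
  not, and the comparison goes through the clipped marks.
\<close>

lemma campbell_ball_le_of_dcx:
  fixes \<Phi>\<^sub>1 :: "'v \<Rightarrow> 'a::euclidean_space measure" and \<Phi>\<^sub>2 :: "'w \<Rightarrow> 'a measure"
  assumes \<Phi>: "\<Phi>\<^sub>1 \<in> M\<^sub>1 \<rightarrow>\<^sub>M config_space" and pp: "point_process M\<^sub>2 \<Phi>\<^sub>2" and st: "stationary M\<^sub>2 \<Phi>\<^sub>2"
    and le: "pp_dcx_le M\<^sub>1 \<Phi>\<^sub>1 M\<^sub>2 \<Phi>\<^sub>2"
    and mean: "\<And>R. R \<in> sets borel \<Longrightarrow> bounded R \<Longrightarrow> (\<integral>\<^sup>+\<omega>. emeasure (\<Phi>\<^sub>1 \<omega>) R \<partial>M\<^sub>1) < \<infinity>"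
      "\<And>R. R \<in> sets borel \<Longrightarrow> bounded R \<Longrightarrow> (\<integral>\<^sup>+\<omega>. emeasure (\<Phi>\<^sub>2 \<omega>) R \<partial>M\<^sub>2) < \<infinity>"
    and G: "G \<in> sets borel" "bounded G" "0 < emeasure lborel G" and r: "0 \<le> r"
  shows "campbell M\<^sub>1 \<Phi>\<^sub>1 (ball_mark (\<lambda>u. u) r) G \<le> campbell M\<^sub>2 \<Phi>\<^sub>2 (ball_mark (\<lambda>u. u) r) G"
proof -
  have \<Phi>2: "\<Phi>\<^sub>2 \<in> M\<^sub>2 \<rightarrow>\<^sub>M config_space" using pp by (simp add: point_process_def)
  have G0: "G \<noteq> {}" using G(3) by auto
  have pos: "0 < 1 / real (Suc n)" for n by (simp del: of_nat_Suc)
  consider "r = 0" | "campbell M\<^sub>2 \<Phi>\<^sub>2 (ball_mark (\<lambda>u. u) r) G = \<infinity>"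
    | "0 < r" "campbell M\<^sub>2 \<Phi>\<^sub>2 (ball_mark (\<lambda>u. u) r) G < \<infinity>"
    using r by (fastforce simp: less_top)
  then show ?thesis
  proof cases
    case 1
    have "campbell M\<^sub>1 \<Phi>\<^sub>1 (ball_mark (clip_slope k) 0) G \<le> campbell M\<^sub>2 \<Phi>\<^sub>2 (ball_mark (clip_slope k) 0) G"
      if k: "0 < k" for k
    proof (rule LIMSEQ_le_const)
      show "(\<lambda>n. campbell M\<^sub>2 \<Phi>\<^sub>2 (ball_mark (clip_slope k) (0 + 1 / real (Suc n))) G)
          \<longlonglongrightarrow> campbell M\<^sub>2 \<Phi>\<^sub>2 (ball_mark (clip_slope k) 0) G"
      proof (rule campbell_ball_right_continuous[OF \<Phi>2 G(1) continuous_clip_slope[OF k]])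
        have "campbell M\<^sub>2 \<Phi>\<^sub>2 (ball_mark (clip_slope k) (0 + 1)) G \<le> campbell M\<^sub>2 \<Phi>\<^sub>2 (\<lambda>_ _. ennreal (2 * k)) G"
          using k by (intro campbell_mono[OF \<Phi>2]) (auto simp: ball_mark_def intro!: ennreal_leI clip_slope_le_bound)
        also have "\<dots> = (\<integral>\<^sup>+\<omega>. ennreal (2 * k) * emeasure (\<Phi>\<^sub>2 \<omega>) G \<partial>M\<^sub>2)"
          unfolding campbell_def using measurable_space[OF \<Phi>2] G
          by (intro nn_integral_cong) (simp add: nn_integral_cmult_indicator)
        also have "\<dots> = ennreal (2 * k) * (\<integral>\<^sup>+\<omega>. emeasure (\<Phi>\<^sub>2 \<omega>) G \<partial>M\<^sub>2)"
          using measurable_count_process(1)[OF \<Phi>2 G(1,2)] by (rule nn_integral_cmult)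
        also have "\<dots> < \<infinity>"
          using mean(2)[OF G(1,2)] by (simp add: ennreal_mult_less_top)
        finally show "campbell M\<^sub>2 \<Phi>\<^sub>2 (ball_mark (clip_slope k) (0 + 1)) G < \<infinity>" .
      qed (rule clip_slope_mono[OF k])
      show "\<exists>N. \<forall>n\<ge>N. campbell M\<^sub>1 \<Phi>\<^sub>1 (ball_mark (clip_slope k) 0) G
          \<le> campbell M\<^sub>2 \<Phi>\<^sub>2 (ball_mark (clip_slope k) (0 + 1 / real (Suc n))) G"
        unfolding add_0_left
        by (intro exI allI impI, rule campbell_clip_dcx_le[OF \<Phi> \<Phi>2 le mean G(1,2) G0 k pos])
    qed
    then show ?thesis
      unfolding 1 campbell_SUP_clip[OF \<Phi> G(1)] campbell_SUP_clip[OF \<Phi>2 G(1)]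
      by (intro SUP_mono') simp
  next
    case 2
    then show ?thesis by simp
  next
    case 3
    have meas: "case_prod (ball_mark (\<lambda>u. u) r) \<in> borel_measurable (config_space \<Otimes>\<^sub>M (borel :: 'a measure))"
      by (rule measurable_ball_mark) simp
    have second2: "(\<integral>\<^sup>+\<omega>. (emeasure (\<Phi>\<^sub>2 \<omega>) R)\<^sup>2 \<partial>M\<^sub>2) < \<infinity>" if R: "R \<in> sets borel" "bounded R" for R
    proof (rule second_moment_finite[OF \<Phi>2 R 3(1)])
      have "campbell M\<^sub>2 \<Phi>\<^sub>2 (ball_mark (\<lambda>u. u) r) R * emeasure lborel G =
          campbell M\<^sub>2 \<Phi>\<^sub>2 (ball_mark (\<lambda>u. u) r) G * emeasure lborel R"
        using campbell_proportional_lborel[OF pp st meas _ R(1) G(1)]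
        by (simp add: ball_mark_id shift_point_config emeasure_shift_cball)
      also have "\<dots> < \<infinity>"
        using 3(2) emeasure_bounded_finite[OF R(2)] by (simp add: ennreal_mult_less_top)
      finally show "campbell M\<^sub>2 \<Phi>\<^sub>2 (ball_mark (\<lambda>u. u) r) R < \<infinity>"
        using G(3) by (auto simp: ennreal_mult_less_top)
    qed
    have second1: "(\<integral>\<^sup>+\<omega>. (emeasure (\<Phi>\<^sub>1 \<omega>) R)\<^sup>2 \<partial>M\<^sub>1) < \<infinity>" if R: "R \<in> sets borel" "bounded R" for R
      using second_moment_dcx_le[OF \<Phi> \<Phi>2 le mean R] second2[OF R] by (rule le_less_trans)
    show ?thesis
    proof (rule LIMSEQ_le_const)
      show "(\<lambda>n. campbell M\<^sub>2 \<Phi>\<^sub>2 (ball_mark (\<lambda>u. u) (r + 1 / real (Suc n))) G)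
          \<longlonglongrightarrow> campbell M\<^sub>2 \<Phi>\<^sub>2 (ball_mark (\<lambda>u. u) r) G"
        by (rule campbell_ball_right_continuous[OF \<Phi>2 G(1)])
           (simp_all add: campbell_ball_finite[OF \<Phi>2 G(1,2) second2, simplified])
      show "\<exists>N. \<forall>n\<ge>N. campbell M\<^sub>1 \<Phi>\<^sub>1 (ball_mark (\<lambda>u. u) r) G
          \<le> campbell M\<^sub>2 \<Phi>\<^sub>2 (ball_mark (\<lambda>u. u) (r + 1 / real (Suc n))) G"
        by (intro exI[of _ 0] allI impI, rule campbell_ball_dcx_le[OF \<Phi> \<Phi>2 le second1 second2 G(1,2) G0 pos])
    qed
  qed
qed

theorem proposition3p4:
  fixes M\<^sub>1 :: "'v measure" and \<Phi>\<^sub>1 :: "'v \<Rightarrow> 'a::euclidean_space measure"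
    and M\<^sub>2 :: "'w measure" and \<Phi>\<^sub>2 :: "'w \<Rightarrow> 'a measure"
    and B\<^sub>1 B\<^sub>2 G\<^sub>1 G\<^sub>2 :: "'a set" and r :: real
  assumes "point_process M\<^sub>1 \<Phi>\<^sub>1" and "point_process M\<^sub>2 \<Phi>\<^sub>2"
    and "stationary M\<^sub>1 \<Phi>\<^sub>1" and "stationary M\<^sub>2 \<Phi>\<^sub>2"
    and "B\<^sub>1 \<in> sets borel" and "bounded B\<^sub>1" and "emeasure lborel B\<^sub>1 = 1"
    and "B\<^sub>2 \<in> sets borel" and "bounded B\<^sub>2" and "emeasure lborel B\<^sub>2 = 1"
    and "intensity M\<^sub>1 \<Phi>\<^sub>1 B\<^sub>1 = intensity M\<^sub>2 \<Phi>\<^sub>2 B\<^sub>2"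
    and "0 < intensity M\<^sub>1 \<Phi>\<^sub>1 B\<^sub>1" and "intensity M\<^sub>1 \<Phi>\<^sub>1 B\<^sub>1 < \<infinity>"
    and "G\<^sub>1 \<in> sets borel" and "bounded G\<^sub>1" and "0 < emeasure lborel G\<^sub>1"
    and "G\<^sub>2 \<in> sets borel" and "bounded G\<^sub>2" and "0 < emeasure lborel G\<^sub>2"
    and "pp_dcx_le M\<^sub>1 \<Phi>\<^sub>1 M\<^sub>2 \<Phi>\<^sub>2"
  shows "ripley_K M\<^sub>1 \<Phi>\<^sub>1 B\<^sub>1 G\<^sub>1 r \<le> ripley_K M\<^sub>2 \<Phi>\<^sub>2 B\<^sub>2 G\<^sub>2 r"
proof -
  have \<Phi>: "\<Phi>\<^sub>1 \<in> M\<^sub>1 \<rightarrow>\<^sub>M config_space" "\<Phi>\<^sub>2 \<in> M\<^sub>2 \<rightarrow>\<^sub>M config_space"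
    using assms(1,2) by (auto simp: point_process_def)
  define J\<^sub>1 where "J\<^sub>1 = campbell M\<^sub>1 \<Phi>\<^sub>1 (\<lambda>N x. emeasure N (cball x r) - 1) B\<^sub>1"
  define J\<^sub>2 where "J\<^sub>2 = campbell M\<^sub>2 \<Phi>\<^sub>2 (\<lambda>N x. emeasure N (cball x r) - 1) B\<^sub>1"
  have int: "intensity M\<^sub>2 \<Phi>\<^sub>2 B\<^sub>1 = intensity M\<^sub>1 \<Phi>\<^sub>1 B\<^sub>1"
    using intensity_proportional_lborel[OF assms(2,4,8,10,5)] assms(7,11) by simp
  have K: "ripley_K M\<^sub>1 \<Phi>\<^sub>1 B\<^sub>1 G\<^sub>1 r = J\<^sub>1 / intensity M\<^sub>1 \<Phi>\<^sub>1 B\<^sub>1"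
    "ripley_K M\<^sub>2 \<Phi>\<^sub>2 B\<^sub>2 G\<^sub>2 r = J\<^sub>2 / intensity M\<^sub>1 \<Phi>\<^sub>1 B\<^sub>1"
    unfolding J\<^sub>1_def J\<^sub>2_def int[symmetric]
    using ripley_K_eq[OF assms(1,3,5,7,5,7,14,15,16)] ripley_K_eq[OF assms(2,4,8,10,5,7,17,18,19)] int
    by simp_all
  have "J\<^sub>1 \<le> J\<^sub>2"
  proof (cases "0 \<le> r")
    case True
    have "campbell M\<^sub>1 \<Phi>\<^sub>1 (ball_mark (\<lambda>u. u) r) B\<^sub>1 \<le> campbell M\<^sub>2 \<Phi>\<^sub>2 (ball_mark (\<lambda>u. u) r) B\<^sub>1"
    proof (rule campbell_ball_le_of_dcx[OF \<Phi>(1) assms(2,4,20) _ _ assms(5,6) _ True])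
      show "(\<integral>\<^sup>+\<omega>. emeasure (\<Phi>\<^sub>1 \<omega>) R \<partial>M\<^sub>1) < \<infinity>" if "R \<in> sets borel" "bounded R" for R
        by (rule intensity_finite[OF assms(1,3,5,7,13) that])
      show "(\<integral>\<^sup>+\<omega>. emeasure (\<Phi>\<^sub>2 \<omega>) R \<partial>M\<^sub>2) < \<infinity>" if "R \<in> sets borel" "bounded R" for R
        using intensity_finite[OF assms(2,4,8,10) _ that] assms(11,13) by simp
      show "0 < emeasure lborel B\<^sub>1" using assms(7) by simp
    qed
    then show ?thesis
      using assms(13)
      by (auto simp: campbell_ball_decompose[OF \<Phi>(1) assms(5) True] campbell_ball_decompose[OF \<Phi>(2) assms(5) True]
          int J\<^sub>1_def J\<^sub>2_def ennreal_add_left_cancel_le)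
  next
    case False
    then show ?thesis by (simp add: J\<^sub>1_def campbell_def)
  qed
  then show ?thesis
    unfolding K by (rule divide_right_mono_ennreal)
qed

end
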